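(* Let $2p>q>p\ge1$, $\alpha>-1$, $u\in H(\mathbb{R}^2_+)$ and let $\varphi:\mathbb{R}^2_+\to\mathbb{R}^2_+$ be a holomorphic mapping. Suppose that $$\mathbb{Z}_{p,q}:=\{N\in\mathbb{N}:\ N\ge1,\ N<p<q<p+N\}\neq\emptyset.$$ Then the following statements are equivalent. (i) $W_{u,\varphi}:A^p_\alpha\to A^q_\alpha$ is bounded. (ii) There is a constant $C>0$ (independent of $f$) such that for every $f\in A^p_\alpha$, $$\|W_{u,\varphi}f\|_{q,\alpha}^q\le C\inf_{N\in\mathbb{Z}_{p,q}}\left(\sum_{i=1}^3\sum_{I\in\mathcal{D}^i}A_\alpha(Q_I)^{\frac qp}\,\langle|f|^N\rangle_{Q_I}\cdot\langle|f|^{q-N}\rangle_{Q_I}\right).$$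
   Context: $\mathbb{R}^2_+=\{z\in\mathbb{C}:\operatorname{Im}z>0\}$ and $H(\mathbb{R}^2_+)$ is the set of holomorphic functions on $\mathbb{R}^2_+$. For $\alpha>-1$, $dA_\alpha(z)=\frac1\pi(\alpha+1)(2\operatorname{Im}z)^\alpha\,dx\,dy$ ($z=x+iy$), $A_\alpha(E)=\int_E dA_\alpha$, and for $0<p<\infty$, $\|f\|_{p,\alpha}=\left(\int_{\mathbb{R}^2_+}|f|^p\,dA_\alpha\right)^{1/p}$. The weighted Bergman space $A^p_\alpha$ is the set of $f\in H(\mathbb{R}^2_+)$ with $\|f\|_{p,\alpha}<\infty$. For $u\in H(\mathbb{R}^2_+)$ and $\varphi:\mathbb{R}^2_+\to\mathbb{R}^2_+$ holomorphic, the weighted composition operator is $W_{u,\varphi}f(z)=u(z)f(\varphi(z))$; $W_{u,\varphi}:A^p_\alpha\to A^q_\alpha$ is bounded if there is $C$ with $\|W_{u,\varphi}f\|_{q,\alpha}\le C\|f\|_{p,\alpha}$ for all $f\in A^p_\alpha$. For an interval $I\subset\mathbb{R}$ of length $|I|=\ell(I)$, the Carleson box is $Q_I=\{x+iy\in\mathbb{R}^2_+:x\in I,\ y<|I|\}$. A dyadic grid on $\mathbb{R}$ is a collection $\mathcal{D}$ of intervals such that: each $I\in\mathcal{D}$ has $\ell(I)=2^k$ for some $k\in\mathbb{Z}$; for $I,J\in\mathcal{D}$, $I\cap J\in\{I,J,\emptyset\}$; and for every $k\in\mathbb{Z}$ the intervals of $\mathcal{D}$ of length $2^k$ form a partition of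 $\mathbb{R}$. $\mathcal{D}^1,\mathcal{D}^2,\mathcal{D}^3$ are three fixed dyadic grids such that for every interval $I$ there exist $k\in\{1,2,3\}$ and $J\in\mathcal{D}^k$ with $I\subset J$ and $\ell(J)\le3\ell(I)$. For measurable $E\subset\mathbb{R}^2_+$ and $g\ge0$, $\langle g\rangle_E=\frac1{A_\alpha(E)}\int_E g\,dA_\alpha$. Sums of nonnegative terms may equal $+\infty$. *)

theory Defs
  imports "HOL-Analysis.Analysis" "HOL-Library.Disjoint_Sets"
begin

definition upper_half_plane :: "complex set" where
  "upper_half_plane = {z. Im z > 0}"

definition dA :: "real \<Rightarrow> complex measure" where
  "dA \<alpha> = density (restrict_space lborel upper_half_plane)
             (\<lambda>z. ennreal (1 / pi * (\<alpha> + 1) * (2 * Im z) powr \<alpha>))"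

text \<open>Real powers on \<open>[0,\<infinity>]\<close>, used for positive exponents only, so that
  \<open>\<infinity>\<close> is sent to \<open>\<infinity>\<close> and \<open>0\<close> to \<open>0\<close>.\<close>

definition ennpowr :: "ennreal \<Rightarrow> real \<Rightarrow> ennreal" where
  "ennpowr x a = (if x = \<infinity> then \<infinity> else ennreal (enn2real x powr a))"

definition bergman_norm :: "real \<Rightarrow> real \<Rightarrow> (complex \<Rightarrow> complex) \<Rightarrow> ennreal" where
  "bergman_norm p \<alpha> f = ennpowr (\<integral>\<^sup>+z. ennreal (norm (f z) powr p) \<partial>dA \<alpha>) (1 / p)"

definition bergman_space :: "real \<Rightarrow> real \<Rightarrow> (complex \<Rightarrow> complex) set" where
  "bergman_space p \<alpha> = {f. f holomorphic_on upper_half_plane \<and> bergman_norm p \<alpha> f < \<infinity>}"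

definition weighted_comp ::
  "(complex \<Rightarrow> complex) \<Rightarrow> (complex \<Rightarrow> complex) \<Rightarrow> (complex \<Rightarrow> complex) \<Rightarrow> complex \<Rightarrow> complex" where
  "weighted_comp u \<phi> f = (\<lambda>z. u z * f (\<phi> z))"

definition bergman_bounded ::
  "real \<Rightarrow> real \<Rightarrow> real \<Rightarrow> ((complex \<Rightarrow> complex) \<Rightarrow> complex \<Rightarrow> complex) \<Rightarrow> bool" where
  "bergman_bounded \<alpha> p q T \<longleftrightarrow>
     (\<exists>C::real. \<forall>f\<in>bergman_space p \<alpha>.
        bergman_norm q \<alpha> (T f) \<le> ennreal C * bergman_norm p \<alpha> f)"

text \<open>Lebesgue measure is the usual length on bounded intervals. Unbounded intervals
  have \<open>ilength\<close> \<open>0\<close>, so they are excluded wherever the length is required to be positive.\<close>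

definition ilength :: "real set \<Rightarrow> real" where
  "ilength I = measure lborel I"

definition carleson_box :: "real set \<Rightarrow> complex set" where
  "carleson_box I = {z \<in> upper_half_plane. Re z \<in> I \<and> Im z < ilength I}"

text \<open>The intervals may be open, closed or half-open.\<close>

definition dyadic_grid :: "real set set \<Rightarrow> bool" where
  "dyadic_grid \<D> \<longleftrightarrow>
     (\<forall>I\<in>\<D>. is_interval I \<and> (\<exists>k::int. ilength I = 2 powi k)) \<and>
     (\<forall>I\<in>\<D>. \<forall>J\<in>\<D>. I \<inter> J \<in> {I, J, {}}) \<and>
     (\<forall>k::int. partition_on UNIV {I\<in>\<D>. ilength I = 2 powi k})"

text \<open>The covering property is required of intervals of positive length only:
  a single point lies in no grid interval of length at most \<open>3 * 0\<close>.\<close>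

definition covering_dyadic_grids :: "(nat \<Rightarrow> real set set) \<Rightarrow> bool" where
  "covering_dyadic_grids \<D> \<longleftrightarrow>
     (\<forall>i\<in>{1..3}. dyadic_grid (\<D> i)) \<and>
     (\<forall>I. is_interval I \<and> bounded I \<and> ilength I > 0 \<longrightarrow>
        (\<exists>i\<in>{1..3}. \<exists>J\<in>\<D> i. I \<subseteq> J \<and> ilength J \<le> 3 * ilength I))"

definition average :: "real \<Rightarrow> complex set \<Rightarrow> (complex \<Rightarrow> real) \<Rightarrow> ennreal" where
  "average \<alpha> E g = (\<integral>\<^sup>+z\<in>E. ennreal (g z) \<partial>dA \<alpha>) / emeasure (dA \<alpha>) E"

definition Z_set :: "real \<Rightarrow> real \<Rightarrow> nat set" where
  "Z_set p q = {N. N \<ge> 1 \<and> real N < p \<and> p < q \<and> q < p + real N}"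

end

theory Submission
  imports Defs "HOL-Complex_Analysis.Cauchy_Integral_Formula"
begin

text \<open>
  Write \<open>Q\<close> for the Carleson box over a grid interval of length \<open>l\<close>, \<open>A\<close> for its area, which
  is of order \<open>l powr (2 + \<alpha>)\<close>, and \<open>\<langle>g\<rangle>\<close> for the mean of \<open>g\<close> over \<open>Q\<close>.

  The estimate by grid sums implies boundedness because the grid sum of every \<open>f\<close> is at most a constant
  times the \<open>q\<close>-th power of the norm of \<open>f\<close>, whatever the operator is. To see this, insert the weight
  \<open>w = (Im z / l) powr \<delta>\<close>. A Hoelder type argument bounds \<open>\<langle>norm f powr s\<rangle>\<close> by a constant times
  \<open>\<langle>w * norm f powr p\<rangle> powr (s / p)\<close> for \<open>0 < s < p\<close>, as long as \<open>\<delta>\<close> is so small that a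
  certain negative power of \<open>w\<close> has a finite mean; this is possible since \<open>\<alpha> > -1\<close>. With
  \<open>s = N\<close> and \<open>s = q - N\<close> the product of the two means, times \<open>A powr (q / p)\<close>, is at most a
  constant times \<open>b powr (q / p)\<close>, where \<open>b\<close> is the integral of \<open>w * norm f powr p\<close> over
  \<open>Q\<close>. As \<open>q / p > 1\<close>, it suffices to sum \<open>b\<close> itself, and the weights of
  all boxes containing a given point form a geometric series (\<open>dyadic_sum_le\<close>).

  Conversely, suppose that the operator is bounded. Testing it on powers of \<open>1 / (z - a)\<close> with
  the pole \<open>a\<close> at depth \<open>l\<close> below the interval shows that the image of the measure
  \<open>norm u powr q\<close> times \<open>dA\<close> under \<open>\<phi>\<close> gives to \<open>Q\<close> at most a constant times
  \<open>A powr (q / p)\<close> (\<open>bounded_imp_carleson_measure\<close>). On the other hand, each of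
  \<open>norm (f z) powr N\<close> and \<open>norm (f z) powr (q - N)\<close> is at most a constant times its mean over
  the disc of radius \<open>Im z / 2\<close> about \<open>z\<close>, hence times its mean over a grid box that contains the disc and
  has comparable size; the covering property of the three grids supplies such a box
  (\<open>norm_powr_le_grid_sum\<close>). Integrating the resulting pointwise bound for \<open>norm (f z) powr q\<close>
  against the image measure gives the grid sum.

  The exponent \<open>q - N\<close> may be less than \<open>1\<close>. The sub-mean value property is therefore obtained from
  a maximum point of \<open>norm f\<close> times a power of the distance to the boundary of the disc, together with Cauchy's
  estimate (\<open>holomorphic_large_disc\<close>), an argument that is uniform in the exponent.
\<close>

section \<open>Powers and sums in \<open>[0,\<infinity>]\<close>\<close>

lemma ennpowr_ennreal: "0 \<le> x \<Longrightarrow> ennpowr (ennreal x) a = ennreal (x powr a)"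
  by (simp add: ennpowr_def)

lemma ennpowr_mono:
  assumes "0 \<le> a" "x \<le> y"
  shows "ennpowr x a \<le> ennpowr y a"
  using assms by (cases x; cases y) (auto simp: ennpowr_def powr_mono2 top_unique)

lemma ennpowr_ennpowr: "ennpowr (ennpowr x a) b = ennpowr x (a * b)"
  by (cases x) (auto simp: ennpowr_def powr_powr)

lemma ennpowr_one: "ennpowr x 1 = x"
  by (cases x) (auto simp: ennpowr_def)

lemma ennpowr_cmult:
  assumes "0 < c"
  shows "ennpowr (ennreal c * x) a = ennreal (c powr a) * ennpowr x a"
  using assms
  by (cases x) (auto simp: ennpowr_def powr_mult ennreal_mult_top ennreal_mult simp flip: ennreal_mult)

lemma ennpowr_less_top: "ennpowr x a < \<infinity> \<longleftrightarrow> x < \<infinity>"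
  by (cases x) (auto simp: ennpowr_def)

lemma bergman_norm_powr:
  "ennpowr (bergman_norm p \<alpha> f) q
     = ennpowr (\<integral>\<^sup>+z. ennreal (norm (f z) powr p) \<partial>dA \<alpha>) (q / p)"
  by (simp add: bergman_norm_def ennpowr_ennpowr)

lemma bergman_norm_powr_same:
  "p \<noteq> 0 \<Longrightarrow> ennpowr (bergman_norm p \<alpha> f) p = (\<integral>\<^sup>+z. ennreal (norm (f z) powr p) \<partial>dA \<alpha>)"
  by (simp add: bergman_norm_powr ennpowr_one)

lemma infsum_ennreal_leI:
  fixes f :: "'a \<Rightarrow> ennreal"
  assumes "\<And>F. finite F \<Longrightarrow> F \<subseteq> A \<Longrightarrow> sum f F \<le> b"
  shows "infsum f A \<le> b"
  by (subst nonneg_infsum_complete) (auto intro!: SUP_least assms)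

lemma infsum_ennreal_cmult:
  fixes f :: "'a \<Rightarrow> ennreal"
  assumes "c < \<infinity>"
  shows "(\<Sum>\<^sub>\<infinity>x\<in>A. c * f x) = c * infsum f A"
  by (simp add: nonneg_infsum_complete SUP_mult_left_ennreal flip: sum_distrib_left)

lemma infsum_ennreal_eq_suminf:
  fixes g :: "'i \<Rightarrow> ennreal"
  assumes "countable A" "infinite A"
  shows "infsum g A = (\<Sum>n. g (from_nat_into A n))"
proof -
  have "infsum g A = (\<Sum>\<^sub>\<infinity>n. g (from_nat_into A n))"
    by (rule infsum_reindex_bij_betw[OF bij_betw_from_nat_into[OF assms], symmetric])
  also have "\<dots> = (\<Sum>n. g (from_nat_into A n))"
    by (intro sums_unique has_sum_imp_sums has_sum_infsum nonneg_summable_on_complete) simp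
  finally show ?thesis .
qed

text \<open>Countability cannot be dropped from the next two facts: an uncountable family of functions that
  vanish off single points sums to an arbitrary function. A countable infinite index set is
  enumerated, which turns the sum into a series.\<close>

lemma borel_measurable_infsum_ennreal:
  fixes f :: "'i \<Rightarrow> 'a \<Rightarrow> ennreal"
  assumes A: "countable A" and f: "\<And>x. x \<in> A \<Longrightarrow> f x \<in> borel_measurable M"
  shows "(\<lambda>z. \<Sum>\<^sub>\<infinity>x\<in>A. f x z) \<in> borel_measurable M"
proof (cases "finite A")
  case True
  then show ?thesis
    using f by (simp add: borel_measurable_sum)
next
  case False
  then have [measurable]: "f (from_nat_into A n) \<in> borel_measurable M" for n
    by (intro f from_nat_into) auto
  show ?thesis
    unfolding infsum_ennreal_eq_suminf[OF A False] by measurable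
qed

lemma nn_integral_infsum:
  fixes f :: "'i \<Rightarrow> 'a \<Rightarrow> ennreal"
  assumes A: "countable A" and f: "\<And>x. x \<in> A \<Longrightarrow> f x \<in> borel_measurable M"
  shows "(\<integral>\<^sup>+z. (\<Sum>\<^sub>\<infinity>x\<in>A. f x z) \<partial>M) = (\<Sum>\<^sub>\<infinity>x\<in>A. \<integral>\<^sup>+z. f x z \<partial>M)"
proof (cases "finite A")
  case True
  then show ?thesis
    using f by (simp add: nn_integral_sum)
next
  case False
  show ?thesis
    unfolding infsum_ennreal_eq_suminf[OF A False]
    using False by (intro nn_integral_suminf f from_nat_into) auto
qed

section \<open>The measure \<open>dA\<close> and Carleson boxes\<close>

lemma open_upper_half_plane: "open upper_half_plane"
  unfolding upper_half_plane_def by (rule open_halfspace_Im_gt)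

lemma sets_upper_half_plane [measurable]: "upper_half_plane \<in> sets borel"
  by (simp add: open_upper_half_plane)

lemma sets_dA [measurable_cong]: "sets (dA \<alpha>) = sets (restrict_space borel upper_half_plane)"
  by (simp add: dA_def cong: sets_restrict_space_cong)

lemma space_dA [simp]: "space (dA \<alpha>) = upper_half_plane"
  by (simp add: dA_def space_restrict_space)

lemma continuous_on_measurable_dA:
  fixes f :: "complex \<Rightarrow> 'b::topological_space"
  assumes "continuous_on upper_half_plane f"
  shows "f \<in> borel_measurable (dA \<alpha>)"
  using borel_measurable_continuous_on_restrict[OF assms]
  by (simp cong: measurable_cong_sets add: sets_dA)

lemma borel_measurable_dA:
  assumes "f \<in> borel_measurable borel"
  shows "f \<in> borel_measurable (dA \<alpha>)"
  using measurable_restrict_space1[OF assms]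
  by (simp cong: measurable_cong_sets add: sets_dA)

lemma nn_integral_dA:
  assumes "g \<in> borel_measurable (dA \<alpha>)"
  shows "(\<integral>\<^sup>+z. g z \<partial>dA \<alpha>) = (\<integral>\<^sup>+z. ennreal (1 / pi * (\<alpha> + 1) * (2 * Im z) powr \<alpha>) * g z
           * indicator upper_half_plane z \<partial>lborel)"
proof -
  have "g \<in> borel_measurable (restrict_space lborel upper_half_plane)"
    using assms by (simp add: dA_def)
  moreover have "(\<lambda>z. ennreal (1 / pi * (\<alpha> + 1) * (2 * Im z) powr \<alpha>))
      \<in> borel_measurable (restrict_space lborel upper_half_plane)"
    by (intro measurable_restrict_space1) simp
  ultimately show ?thesis
    unfolding dA_def
    by (simp add: nn_integral_density nn_integral_restrict_space)
qed

text \<open>Fubini in Cartesian coordinates: boxes have the same area on both sides, so planar Lebesgue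
  measure is the image of the product measure.\<close>

lemma nn_integral_lborel_complex:
  fixes g :: "complex \<Rightarrow> ennreal"
  assumes [measurable]: "g \<in> borel_measurable borel"
  shows "(\<integral>\<^sup>+z. g z \<partial>lborel) = (\<integral>\<^sup>+y. \<integral>\<^sup>+x. g (Complex x y) \<partial>lborel \<partial>lborel)"
proof -
  have meas [measurable]: "(\<lambda>(x, y). Complex x y) \<in> lborel \<Otimes>\<^sub>M lborel \<rightarrow>\<^sub>M borel"
    unfolding Complex_eq case_prod_beta' by measurable
  have "lborel = distr (lborel \<Otimes>\<^sub>M lborel) borel (\<lambda>(x, y). Complex x y)"
  proof (rule lborel_eqI)
    fix l u :: complex
    assume le: "\<And>b. b \<in> Basis \<Longrightarrow> l \<bullet> b \<le> u \<bullet> b"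
    have lu: "Re l \<le> Re u" "Im l \<le> Im u"
      using le[of 1] le[of \<i>] by (auto simp: Basis_complex_def)
    have "(\<lambda>(x, y). Complex x y) -` box l u \<inter> space (lborel \<Otimes>\<^sub>M lborel)
            = {Re l<..<Re u} \<times> {Im l<..<Im u}"
      by (auto simp: in_box_complex_iff space_pair_measure)
    then show "emeasure (distr (lborel \<Otimes>\<^sub>M lborel) borel (\<lambda>(x, y). Complex x y)) (box l u)
                 = ennreal (\<Prod>b\<in>Basis. (u - l) \<bullet> b)"
      using lu by (simp add: emeasure_distr lborel.emeasure_pair_measure_Times Basis_complex_def
          ennreal_mult' )
  qed simp
  then have "(\<integral>\<^sup>+z. g z \<partial>lborel)
      = (\<integral>\<^sup>+z. g z \<partial>distr (lborel \<Otimes>\<^sub>M lborel) borel (\<lambda>(x, y). Complex x y))"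
    by simp
  also have "\<dots> = (\<integral>\<^sup>+w. g (case w of (x, y) \<Rightarrow> Complex x y) \<partial>(lborel \<Otimes>\<^sub>M lborel))"
    by (simp add: nn_integral_distr)
  also have "\<dots> = (\<integral>\<^sup>+y. \<integral>\<^sup>+x. g (Complex x y) \<partial>lborel \<partial>lborel)"
    by (subst lborel_pair.nn_integral_snd[symmetric]) (auto simp: split_beta)
  finally show ?thesis .
qed

text \<open>A positive \<open>ilength\<close> rules out infinite measure, because \<open>measure\<close> sends infinite
  measures to \<open>0\<close>; so \<open>0 < ilength I\<close> also expresses that an interval is bounded.\<close>

lemma emeasure_ilength: "0 < ilength I \<Longrightarrow> emeasure lborel I = ennreal (ilength I)"
  unfolding ilength_def
  by (rule emeasure_eq_ennreal_measure) (auto simp: measure_def)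

lemma dist_le_ilength:
  assumes I: "is_interval I" and pos: "0 < ilength I" and xy: "x \<in> I" "y \<in> I"
  shows "\<bar>x - y\<bar> \<le> ilength I"
proof -
  define a b where "a = min x y" and "b = max x y"
  have ab: "a \<in> I" "b \<in> I" "a \<le> b" "\<bar>x - y\<bar> = b - a"
    using xy by (auto simp: a_def b_def min_def max_def)
  have "{a..b} \<subseteq> I"
    using mem_is_interval_1_I[OF I ab(1,2)] by auto
  then have "emeasure lborel {a..b} \<le> emeasure lborel I"
    using real_interval_borel_measurable[OF I] by (intro emeasure_mono) simp_all
  then show ?thesis
    using ab pos by (simp add: emeasure_ilength)
qed

lemma ilength_mono:
  assumes "I \<subseteq> J" "J \<in> sets borel" "0 < ilength I" "0 < ilength J"
  shows "ilength I \<le> ilength J"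
  using emeasure_mono[of I J lborel] assms by (simp add: emeasure_ilength)

lemma carleson_box_iff: "z \<in> carleson_box I \<longleftrightarrow> 0 < Im z \<and> Re z \<in> I \<and> Im z < ilength I"
  by (auto simp: carleson_box_def upper_half_plane_def)

lemma carleson_box_subset: "carleson_box I \<subseteq> upper_half_plane"
  by (auto simp: carleson_box_def)

lemma carleson_box_borel [measurable]:
  assumes [measurable]: "I \<in> sets borel"
  shows "carleson_box I \<in> sets borel"
proof -
  have "carleson_box I = upper_half_plane \<inter> (Re -` I \<inter> space borel) \<inter> {z \<in> space borel. Im z < ilength I}"
    by (auto simp: carleson_box_def)
  also have "\<dots> \<in> sets borel"
    by measurable
  finally show ?thesis .
qed

lemma carleson_box_sets_dA [measurable]:
  "I \<in> sets borel \<Longrightarrow> carleson_box I \<in> sets (dA \<alpha>)"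
  using carleson_box_borel[of I] carleson_box_subset[of I]
  by (simp add: sets_dA sets_restrict_space_iff)

text \<open>The area of a box of side \<open>l\<close> is proportional to \<open>l powr (2 + \<alpha>)\<close>, and its
  \<open>\<gamma>\<close>-th moment in height to \<open>l powr (2 + \<alpha> + \<gamma>)\<close>; this is the factor of
  proportionality. The moment is finite exactly for \<open>\<alpha> + \<gamma> > -1\<close>, which leaves room for some
  negative \<open>\<gamma>\<close>.\<close>

definition box_const :: "real \<Rightarrow> real \<Rightarrow> real" where
  "box_const \<alpha> \<gamma> = (\<alpha> + 1) * 2 powr \<alpha> / (pi * (\<alpha> + \<gamma> + 1))"

lemma box_const_pos: "-1 < \<alpha> \<Longrightarrow> -1 < \<alpha> + \<gamma> \<Longrightarrow> 0 < box_const \<alpha> \<gamma>"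
  by (simp add: box_const_def)

lemma nn_integral_powr_from_0:
  fixes \<beta> l :: real
  assumes "-1 < \<beta>" "0 < l"
  shows "(\<integral>\<^sup>+y. ennreal (y powr \<beta>) * indicator {0<..<l} y \<partial>lborel)
           = ennreal (l powr (\<beta> + 1) / (\<beta> + 1))"
proof -
  have "((\<lambda>y. y powr \<beta>) has_integral l powr (\<beta> + 1) / (\<beta> + 1)) {0..l}"
    using has_integral_powr_from_0[of \<beta> l] assms by simp
  then have "((\<lambda>y. y powr \<beta>) has_integral l powr (\<beta> + 1) / (\<beta> + 1)) {0<..<l}"
    by (simp add: has_integral_Icc_iff_Ioo)
  then have "(\<integral>\<^sup>+y. ennreal (y powr \<beta> * indicator {0<..<l} y) \<partial>lborel)
      = ennreal (l powr (\<beta> + 1) / (\<beta> + 1))"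
    using nn_integral_has_integral_lebesgue'[of "{0<..<l}" "\<lambda>y. y powr \<beta>"]
    by (simp add: nn_integral_completion ennreal_mult' mult.commute flip: ennreal_indicator)
  then show ?thesis
    by (simp add: ennreal_mult' flip: ennreal_indicator)
qed

lemma nn_integral_carleson_box_powr:
  assumes I [measurable]: "I \<in> sets borel" and pos: "0 < ilength I"
    and \<alpha>: "-1 < \<alpha>" and \<gamma>: "-1 < \<alpha> + \<gamma>"
  shows "(\<integral>\<^sup>+z\<in>carleson_box I. ennreal (Im z powr \<gamma>) \<partial>dA \<alpha>)
           = ennreal (box_const \<alpha> \<gamma> * ilength I powr (2 + \<alpha> + \<gamma>))"
proof -
  define l where "l = ilength I"
  define c where "c = 1 / pi * (\<alpha> + 1) * 2 powr \<alpha>"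
  have c: "0 \<le> c" and l: "0 < l"
    using \<alpha> pos by (simp_all add: c_def l_def)
  have integrand: "ennreal (1 / pi * (\<alpha> + 1) * (2 * Im z) powr \<alpha>)
        * (ennreal (Im z powr \<gamma>) * indicator (carleson_box I) z) * indicator upper_half_plane z
      = ennreal c * (ennreal (Im z powr (\<alpha> + \<gamma>)) * indicator {0<..<l} (Im z)) * indicator I (Re z)"
    for z
  proof (cases "z \<in> carleson_box I")
    case True
    then have "1 / pi * (\<alpha> + 1) * (2 * Im z) powr \<alpha> * Im z powr \<gamma> = c * Im z powr (\<alpha> + \<gamma>)"
      by (auto simp: c_def carleson_box_iff powr_mult powr_add)
    then show ?thesis
      using True c \<alpha> by (auto simp: carleson_box_iff upper_half_plane_def l_def simp flip: ennreal_mult)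
  next
    case False
    then show ?thesis
      by (auto simp: carleson_box_iff l_def indicator_def)
  qed
  have "(\<integral>\<^sup>+z\<in>carleson_box I. ennreal (Im z powr \<gamma>) \<partial>dA \<alpha>)
      = (\<integral>\<^sup>+z. ennreal c * (ennreal (Im z powr (\<alpha> + \<gamma>)) * indicator {0<..<l} (Im z))
           * indicator I (Re z) \<partial>lborel)"
    by (subst nn_integral_dA, simp add: borel_measurable_dA, simp only: integrand)
  also have "\<dots> = (\<integral>\<^sup>+y. \<integral>\<^sup>+x. ennreal c * (ennreal (y powr (\<alpha> + \<gamma>)) * indicator {0<..<l} y)
           * indicator I x \<partial>lborel \<partial>lborel)"
    by (subst nn_integral_lborel_complex) simp_all
  also have "\<dots> = (\<integral>\<^sup>+y. ennreal c * ennreal l * (ennreal (y powr (\<alpha> + \<gamma>)) * indicator {0<..<l} y) \<partial>lborel)"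
    by (subst nn_integral_cmult_indicator) (simp_all add: emeasure_ilength pos l_def mult_ac)
  also have "\<dots> = ennreal c * ennreal l * ennreal (l powr (\<alpha> + \<gamma> + 1) / (\<alpha> + \<gamma> + 1))"
    using \<gamma> l by (subst nn_integral_cmult) (simp_all add: nn_integral_powr_from_0)
  also have "\<dots> = ennreal (box_const \<alpha> \<gamma> * ilength I powr (2 + \<alpha> + \<gamma>))"
  proof -
    have "l * l powr (\<alpha> + \<gamma> + 1) = l powr (2 + \<alpha> + \<gamma>)"
      using l powr_add[of l 1 "\<alpha> + \<gamma> + 1"] by (simp add: algebra_simps)
    moreover have "c * l * (l powr (\<alpha> + \<gamma> + 1) / (\<alpha> + \<gamma> + 1))
        = box_const \<alpha> \<gamma> * (l * l powr (\<alpha> + \<gamma> + 1))"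
      by (simp add: c_def box_const_def)
    ultimately have "c * l * (l powr (\<alpha> + \<gamma> + 1) / (\<alpha> + \<gamma> + 1))
        = box_const \<alpha> \<gamma> * l powr (2 + \<alpha> + \<gamma>)"
      by simp
    then show ?thesis
      using c l \<gamma> by (simp add: l_def flip: ennreal_mult)
  qed
  finally show ?thesis .
qed

lemma emeasure_carleson_box:
  assumes I: "I \<in> sets borel" and pos: "0 < ilength I" and \<alpha>: "-1 < \<alpha>"
  shows "emeasure (dA \<alpha>) (carleson_box I) = ennreal (box_const \<alpha> 0 * ilength I powr (2 + \<alpha>))"
proof -
  have "emeasure (dA \<alpha>) (carleson_box I) = (\<integral>\<^sup>+z. indicator (carleson_box I) z \<partial>dA \<alpha>)"
    using I by simp
  also have "\<dots> = (\<integral>\<^sup>+z\<in>carleson_box I. ennreal (Im z powr 0) \<partial>dA \<alpha>)"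
    by (rule nn_integral_cong) (auto simp: carleson_box_iff indicator_def)
  also have "\<dots> = ennreal (box_const \<alpha> 0 * ilength I powr (2 + \<alpha>))"
    using nn_integral_carleson_box_powr[OF I pos \<alpha>, of 0] \<alpha> by simp
  finally show ?thesis .
qed

section \<open>Dyadic grids\<close>

lemma dyadic_gridD:
  assumes "dyadic_grid \<D>" "I \<in> \<D>"
  shows "is_interval I" "I \<in> sets borel" "0 < ilength I"
proof -
  obtain k :: int where k: "is_interval I" "ilength I = 2 powi k"
    using assms unfolding dyadic_grid_def by blast
  show "is_interval I" "I \<in> sets borel" "0 < ilength I"
    using k real_interval_borel_measurable by simp_all
qed

lemma dyadic_grid_level_unique:
  assumes "dyadic_grid \<D>" "I \<in> \<D>" "J \<in> \<D>" "ilength I = ilength J" "x \<in> I" "x \<in> J"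
  shows "I = J"
proof -
  obtain k :: int where k: "ilength I = 2 powi k"
    using assms unfolding dyadic_grid_def by blast
  have "partition_on UNIV {I \<in> \<D>. ilength I = 2 powi k}"
    using assms unfolding dyadic_grid_def by blast
  then show ?thesis
    using disjointD[of "{I \<in> \<D>. ilength I = 2 powi k}" I J] assms(2-) k
    by (auto simp: partition_on_def)
qed

text \<open>An interval of the grid is determined by its length, an integer power of \<open>2\<close>, and by one
  rational point that it contains.\<close>

lemma countable_dyadic_grid:
  assumes D: "dyadic_grid \<D>"
  shows "countable \<D>"
proof -
  define key where "key I = (ilength I, SOME r. r \<in> I \<inter> \<rat>)" for I
  have rat: "\<exists>r. r \<in> I \<inter> \<rat>" if "I \<in> \<D>" for I
  proof -
    have "infinite I"
      using emeasure_ilength[OF dyadic_gridD(3)[OF D that]] dyadic_gridD(3)[OF D that]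
      by (metis emeasure_lborel_countable countable_finite ennreal_eq_0_iff not_le)
    obtain x where x: "x \<in> I"
      using \<open>infinite I\<close> by (metis finite.emptyI ex_in_conv)
    obtain y where y: "y \<in> I" "y \<noteq> x"
      using \<open>infinite I\<close> finite_subset[of I "{x}"] by auto
    obtain x y where xy: "x \<in> I" "y \<in> I" "x < y"
      using x y by (meson linorder_neqE_linordered_idom)
    obtain r where "x < of_rat r" "of_rat r < y"
      using of_rat_dense[OF xy(3)] by blast
    then show ?thesis
      using mem_is_interval_1_I[OF dyadic_gridD(1)[OF D that] xy(1,2)]
      by (intro exI[of _ "of_rat r"]) auto
  qed
  have "key I \<in> range (\<lambda>k::int. 2 powi k) \<times> \<rat>" if "I \<in> \<D>" for I
    using D that someI_ex[OF rat[OF that]] unfolding key_def dyadic_grid_def by auto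
  then have "key ` \<D> \<subseteq> range (\<lambda>k::int. 2 powi k) \<times> \<rat>"
    by (rule image_subsetI)
  then have "countable (key ` \<D>)"
    by (rule countable_subset) (simp add: countable_rat)
  moreover have "inj_on key \<D>"
  proof (rule inj_onI)
    fix I J assume IJ: "I \<in> \<D>" "J \<in> \<D>" "key I = key J"
    then show "I = J"
      using someI_ex[OF rat[OF IJ(1)]] someI_ex[OF rat[OF IJ(2)]] dyadic_grid_level_unique[OF D]
      by (auto simp: key_def)
  qed
  ultimately show ?thesis
    by (metis countable_image_inj_on)
qed

section \<open>Dyadic sums are bounded by the Bergman norm\<close>

text \<open>A point lies over at most one interval of each length \<open>2 powi k\<close>, and only lengths above its
  height \<open>y\<close> count, so the weights \<open>(y / l) powr \<delta>\<close> are dominated by a geometric series. Without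
  weights (\<open>\<delta> = 0\<close>) the boxes would overlap infinitely often: the weight is what
  makes the family of all boxes act like a disjoint one.\<close>

lemma sum_dyadic_weights_le:
  assumes D: "dyadic_grid \<D>" and \<delta>: "0 < \<delta>" and F: "finite F" "F \<subseteq> \<D>"
  shows "(\<Sum>I\<in>F. indicator (carleson_box I) z * ennreal ((Im z / ilength I) powr \<delta>))
           \<le> ennreal (1 / (1 - 2 powr - \<delta>))"
proof -
  define G where "G = {I \<in> F. z \<in> carleson_box I}"
  define r where "r = 2 powr - \<delta>"
  define k where "k I = \<lfloor>log 2 (ilength I)\<rfloor>" for I
  \<comment> \<open>The lowest level whose intervals can be longer than the height of \<open>z\<close>.\<close>
  define m where "m = \<lfloor>log 2 (Im z)\<rfloor> + 1"
  define j where "j I = nat (k I - m)" for I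
  have r: "0 < r" "r < 1"
    using \<delta> powr_less_mono[of "-\<delta>" 0 "2::real"] by (simp_all add: r_def)
  have G: "finite G" "G \<subseteq> \<D>" "G \<subseteq> F"
    using F by (auto simp: G_def)
  have len: "ilength I = 2 powr real_of_int (k I)" if "I \<in> \<D>" for I
  proof -
    obtain i :: int where "ilength I = 2 powi i"
      using D \<open>I \<in> \<D>\<close> unfolding dyadic_grid_def by blast
    then have "ilength I = 2 powr real_of_int i"
      by (simp add: powr_real_of_int')
    moreover from this have "k I = i"
      by (simp add: k_def)
    ultimately show ?thesis
      by simp
  qed
  have y: "0 < Im z" "Re z \<in> I" "Im z < ilength I" "I \<in> \<D>" if "I \<in> G" for I
    using that G by (auto simp: G_def carleson_box_iff)
  have km: "m \<le> k I" if "I \<in> G" for I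
  proof -
    have "log 2 (Im z) < k I"
      using y[OF that] len[of I] by (simp add: log_less_iff)
    then show ?thesis
      unfolding m_def by linarith
  qed
  have "inj_on j G"
  proof (rule inj_onI)
    fix I J assume IJ: "I \<in> G" "J \<in> G" "j I = j J"
    then have "k I = k J"
      using km[OF IJ(1)] km[OF IJ(2)] by (simp add: j_def)
    then show "I = J"
      using IJ y len by (intro dyadic_grid_level_unique[OF D, of I J "Re z"]) simp_all
  qed
  have weight: "(Im z / ilength I) powr \<delta> \<le> r ^ j I" if "I \<in> G" for I
  proof -
    have "log 2 (Im z) < m"
      unfolding m_def by linarith
    then have "Im z \<le> 2 powr m"
      using y(1)[OF that] by (simp add: log_less_iff)
    then have "Im z / ilength I \<le> 2 powr m / 2 powr k I"
      using len[OF y(4)[OF that]] by (simp add: divide_right_mono)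
    also have "\<dots> = 2 powr - real (j I)"
      using km[OF that] by (simp add: j_def flip: powr_diff)
    finally have "(Im z / ilength I) powr \<delta> \<le> (2 powr - real (j I)) powr \<delta>"
      using y[OF that] \<delta> by (intro powr_mono2) auto
    also have "\<dots> = r powr real (j I)"
      by (simp add: r_def powr_powr mult.commute)
    also have "\<dots> = r ^ j I"
      using r by (simp add: powr_realpow)
    finally show ?thesis .
  qed
  have "(\<Sum>I\<in>F. indicator (carleson_box I) z * ennreal ((Im z / ilength I) powr \<delta>))
      = (\<Sum>I\<in>G. ennreal ((Im z / ilength I) powr \<delta>))"
    using F G by (intro sum.mono_neutral_cong_right) (auto simp: G_def)
  also have "\<dots> = ennreal (\<Sum>I\<in>G. (Im z / ilength I) powr \<delta>)"
    by (simp add: sum_ennreal)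
  also have "\<dots> \<le> ennreal (\<Sum>I\<in>G. r ^ j I)"
    by (intro ennreal_leI sum_mono weight)
  also have "\<dots> = ennreal (\<Sum>i\<in>j ` G. r ^ i)"
    by (simp add: sum.reindex[OF \<open>inj_on j G\<close>])
  also have "\<dots> \<le> ennreal (\<Sum>i. r ^ i)"
    using r G by (intro ennreal_leI sum_le_suminf) (auto intro: summable_geometric)
  also have "\<dots> = ennreal (1 / (1 - r))"
    using r by (simp add: suminf_geometric)
  finally show ?thesis
    by (simp add: r_def)
qed

lemma infsum_weighted_box_integrals_le:
  assumes D: "dyadic_grid \<D>" and \<delta>: "0 < \<delta>" and g [measurable]: "g \<in> borel_measurable (dA \<alpha>)"
  shows "(\<Sum>\<^sub>\<infinity>I\<in>\<D>. \<integral>\<^sup>+z\<in>carleson_box I. ennreal ((Im z / ilength I) powr \<delta>) * g z \<partial>dA \<alpha>)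
           \<le> ennreal (1 / (1 - 2 powr - \<delta>)) * (\<integral>\<^sup>+z. g z \<partial>dA \<alpha>)"
proof (rule infsum_ennreal_leI)
  fix F assume F: "finite F" "F \<subseteq> \<D>"
  have [measurable]: "carleson_box I \<in> sets (dA \<alpha>)" if "I \<in> F" for I
    using F that dyadic_gridD(2)[OF D] by auto
  have [measurable]: "(\<lambda>z. ennreal ((Im z / ilength I) powr \<delta>)) \<in> borel_measurable (dA \<alpha>)" for I
    by (rule borel_measurable_dA) simp
  have "(\<Sum>I\<in>F. \<integral>\<^sup>+z\<in>carleson_box I. ennreal ((Im z / ilength I) powr \<delta>) * g z \<partial>dA \<alpha>)
      = (\<integral>\<^sup>+z. (\<Sum>I\<in>F. ennreal ((Im z / ilength I) powr \<delta>) * g z * indicator (carleson_box I) z) \<partial>dA \<alpha>)"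
    by (rule nn_integral_sum[symmetric]) measurable
  also have "\<dots> = (\<integral>\<^sup>+z. (\<Sum>I\<in>F. indicator (carleson_box I) z * ennreal ((Im z / ilength I) powr \<delta>)) * g z \<partial>dA \<alpha>)"
    by (intro nn_integral_cong) (simp only: sum_distrib_right, simp only: mult_ac)
  also have "\<dots> \<le> (\<integral>\<^sup>+z. ennreal (1 / (1 - 2 powr - \<delta>)) * g z \<partial>dA \<alpha>)"
    by (intro nn_integral_mono mult_right_mono sum_dyadic_weights_le[OF D \<delta> F]) simp
  also have "\<dots> = ennreal (1 / (1 - 2 powr - \<delta>)) * (\<integral>\<^sup>+z. g z \<partial>dA \<alpha>)"
    by (rule nn_integral_cmult) measurable
  finally show "(\<Sum>I\<in>F. \<integral>\<^sup>+z\<in>carleson_box I. ennreal ((Im z / ilength I) powr \<delta>) * g z \<partial>dA \<alpha>)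
           \<le> ennreal (1 / (1 - 2 powr - \<delta>)) * (\<integral>\<^sup>+z. g z \<partial>dA \<alpha>)" .
qed

text \<open>A pointwise substitute for Hoelder's inequality: if the first summand fails to dominate,
  then \<open>x < t * w powr (-1 / (p - s))\<close>, and the second one dominates.\<close>

lemma weighted_power_split:
  fixes x t w s p :: real
  assumes x: "0 \<le> x" and t: "0 < t" and w: "0 < w" and s: "0 < s" "s < p"
  shows "x powr s \<le> t powr s * (w * x powr p / t powr p + w powr - (s / (p - s)))"
proof (cases "t powr (p - s) \<le> w * x powr (p - s)")
  case True
  then have "x > 0"
    using t x by (cases "x = 0") auto
  have "x powr s * t powr (p - s) \<le> x powr s * (w * x powr (p - s))"
    using True by (intro mult_left_mono) simp_all
  also have "\<dots> = w * x powr p"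
    using \<open>x > 0\<close> by (simp flip: powr_add)
  finally have "x powr s \<le> w * x powr p / t powr (p - s)"
    using t by (simp add: field_simps)
  also have "\<dots> = t powr s * (w * x powr p / t powr p)"
    using t by (simp add: powr_diff field_simps)
  also have "\<dots> \<le> t powr s * (w * x powr p / t powr p + w powr - (s / (p - s)))"
    by (intro mult_left_mono) simp_all
  finally show ?thesis .
next
  case False
  then have "x powr (p - s) \<le> t powr (p - s) / w"
    using w by (simp add: field_simps)
  then have "(x powr (p - s)) powr (s / (p - s)) \<le> (t powr (p - s) / w) powr (s / (p - s))"
    using s by (intro powr_mono2) simp_all
  also have "\<dots> = t powr s * w powr - (s / (p - s))"
    using t w s by (simp add: powr_divide powr_powr powr_minus_divide)
  finally have "x powr s \<le> t powr s * w powr - (s / (p - s))"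
    using s by (simp add: powr_powr)
  also have "\<dots> \<le> t powr s * (w * x powr p / t powr p + w powr - (s / (p - s)))"
    using w by (intro mult_left_mono) simp_all
  finally show ?thesis .
qed

text \<open>The mean over any Carleson box of \<open>(Im z / l) powr \<gamma>\<close>, where \<open>l\<close> is the side of the
  box; it does not depend on the box.\<close>

definition moment_ratio :: "real \<Rightarrow> real \<Rightarrow> real" where
  "moment_ratio \<alpha> \<gamma> = box_const \<alpha> \<gamma> / box_const \<alpha> 0"

text \<open>Let \<open>w = (Im z / l) powr \<delta>\<close>, which is at most \<open>1\<close> on the box. Integrating the splitting of
  \<open>g powr s\<close> bounds the mean of \<open>g powr s\<close> by
  \<open>t powr s * (B / (A * t powr p) + const)\<close>, and taking for \<open>t powr p\<close>
  the weighted mean \<open>B / A\<close> turns the bracket into a constant. Here \<open>const\<close> is the mean of \<open>w powr (- s / (p - s))\<close>; the condition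
  on \<open>\<delta>\<close> keeps it finite.\<close>

lemma average_le_weighted_mean:
  assumes I: "I \<in> sets borel" "0 < ilength I" and \<alpha>: "-1 < \<alpha>"
    and s: "0 < s" "s < p" and \<delta>: "0 < \<delta>" "\<delta> * (s / (p - s)) < 1 + \<alpha>"
    and g: "g \<in> borel_measurable (dA \<alpha>)" "\<And>z. 0 \<le> g z"
    and A: "emeasure (dA \<alpha>) (carleson_box I) = ennreal A" "0 < A"
    and B: "(\<integral>\<^sup>+z\<in>carleson_box I. ennreal ((Im z / ilength I) powr \<delta>) * ennreal (g z powr p) \<partial>dA \<alpha>)
              = ennreal B" "0 \<le> B"
  shows "average \<alpha> (carleson_box I) (\<lambda>z. g z powr s)
           \<le> ennreal ((1 + moment_ratio \<alpha> (- (\<delta> * (s / (p - s))))) * (B / A) powr (s / p))"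
proof -
  define l where "l = ilength I"
  define \<beta> where "\<beta> = s / (p - s)"
  define K where "K = moment_ratio \<alpha> (- (\<delta> * \<beta>))"
  define w where "w z = (Im z / l) powr \<delta>" for z
  define X where "X = (\<integral>\<^sup>+z\<in>carleson_box I. ennreal (g z powr s) \<partial>dA \<alpha>)"
  have l: "0 < l" and K: "0 < K"
    using I \<alpha> \<delta> by (simp_all add: l_def K_def moment_ratio_def \<beta>_def box_const_pos)
  note [measurable] = carleson_box_sets_dA[OF I(1)] g(1)
  have [measurable]: "w \<in> borel_measurable (dA \<alpha>)"
    "(\<lambda>z. ennreal (Im z powr c)) \<in> borel_measurable (dA \<alpha>)" for c
    unfolding w_def by (rule borel_measurable_dA, simp)+
  have A_eq: "A = box_const \<alpha> 0 * l powr (2 + \<alpha>)"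
    using emeasure_carleson_box[OF I \<alpha>] A box_const_pos[of \<alpha> 0] \<alpha>
    by (simp add: l_def less_imp_le)
  have w_integral: "(\<integral>\<^sup>+z\<in>carleson_box I. ennreal (w z powr - \<beta>) \<partial>dA \<alpha>) = ennreal (K * A)"
  proof -
    have "(\<integral>\<^sup>+z\<in>carleson_box I. ennreal (w z powr - \<beta>) \<partial>dA \<alpha>)
        = (\<integral>\<^sup>+z. ennreal (l powr (\<delta> * \<beta>)) * (ennreal (Im z powr - (\<delta> * \<beta>)) * indicator (carleson_box I) z) \<partial>dA \<alpha>)"
    proof (rule nn_integral_cong)
      fix z assume "z \<in> space (dA \<alpha>)"
      then have "0 < Im z"
        by (simp add: upper_half_plane_def)
      then have "w z powr - \<beta> = l powr (\<delta> * \<beta>) * Im z powr - (\<delta> * \<beta>)"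
        using l by (simp add: w_def powr_powr powr_divide powr_minus_divide)
      then show "ennreal (w z powr - \<beta>) * indicator (carleson_box I) z
          = ennreal (l powr (\<delta> * \<beta>)) * (ennreal (Im z powr - (\<delta> * \<beta>)) * indicator (carleson_box I) z)"
        by (simp add: ennreal_mult mult.assoc)
    qed
    also have "\<dots> = ennreal (l powr (\<delta> * \<beta>)) * ennreal (box_const \<alpha> (- (\<delta> * \<beta>)) * l powr (2 + \<alpha> - \<delta> * \<beta>))"
      using nn_integral_carleson_box_powr[OF I \<alpha>, of "- (\<delta> * \<beta>)"] \<delta>
      by (subst nn_integral_cmult) (simp_all add: l_def \<beta>_def)
    also have "\<dots> = ennreal (l powr (\<delta> * \<beta>) * (box_const \<alpha> (- (\<delta> * \<beta>)) * l powr (2 + \<alpha> - \<delta> * \<beta>)))"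
      by (rule ennreal_mult'[symmetric]) simp
    also have "l powr (\<delta> * \<beta>) * (box_const \<alpha> (- (\<delta> * \<beta>)) * l powr (2 + \<alpha> - \<delta> * \<beta>)) = K * A"
    proof -
      have "l powr (\<delta> * \<beta>) * l powr (2 + \<alpha> - \<delta> * \<beta>) = l powr (2 + \<alpha>)"
        by (simp flip: powr_add)
      then have "l powr (\<delta> * \<beta>) * (box_const \<alpha> (- (\<delta> * \<beta>)) * l powr (2 + \<alpha> - \<delta> * \<beta>))
          = box_const \<alpha> (- (\<delta> * \<beta>)) * l powr (2 + \<alpha>)"
        by (simp add: mult.left_commute)
      then show ?thesis
        using box_const_pos[of \<alpha> 0] \<alpha> by (simp add: K_def A_eq moment_ratio_def)
    qed
    finally show ?thesis .
  qed
  have B': "(\<integral>\<^sup>+z. ennreal (w z) * ennreal (g z powr p) * indicator (carleson_box I) z \<partial>dA \<alpha>) = ennreal B"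
    using B(1) by (simp add: w_def l_def)
  have w_meas:
    "(\<lambda>z. ennreal (w z) * ennreal (g z powr p) * indicator (carleson_box I) z) \<in> borel_measurable (dA \<alpha>)"
    "(\<lambda>z. ennreal (w z powr - \<beta>) * indicator (carleson_box I) z) \<in> borel_measurable (dA \<alpha>)"
    by measurable
  have X_le: "X \<le> ennreal (t powr s * (B / t powr p + K * A))" if t: "0 < t" for t
  proof -
    have "X \<le> (\<integral>\<^sup>+z. ennreal (t powr s) *
        (ennreal (1 / t powr p) * (ennreal (w z) * ennreal (g z powr p) * indicator (carleson_box I) z)
          + ennreal (w z powr - \<beta>) * indicator (carleson_box I) z) \<partial>dA \<alpha>)"
      unfolding X_def
    proof (rule nn_integral_mono)
      fix z assume "z \<in> space (dA \<alpha>)"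
      then have "0 < w z"
        using l by (simp add: w_def upper_half_plane_def)
      then have "ennreal (g z powr s) \<le> ennreal (t powr s * (1 / t powr p * (w z * g z powr p) + w z powr - \<beta>))"
        using weighted_power_split[OF g(2) t _ s, of "w z" z] by (simp add: \<beta>_def ennreal_leI)
      also have "\<dots> = ennreal (t powr s) * (ennreal (1 / t powr p) * (ennreal (w z) * ennreal (g z powr p))
          + ennreal (w z powr - \<beta>))"
        using \<open>0 < w z\<close> by (simp add: ennreal_mult ennreal_plus del: times_divide_eq_left mult_1)
      finally show "ennreal (g z powr s) * indicator (carleson_box I) z
        \<le> ennreal (t powr s) *
        (ennreal (1 / t powr p) * (ennreal (w z) * ennreal (g z powr p) * indicator (carleson_box I) z)
          + ennreal (w z powr - \<beta>) * indicator (carleson_box I) z)"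
        by (cases "z \<in> carleson_box I") simp_all
    qed
    also have "\<dots> = ennreal (t powr s) * (ennreal (1 / t powr p) * ennreal B + ennreal (K * A))"
      by (subst nn_integral_cmult, use w_meas in measurable, subst nn_integral_add,
          use w_meas in measurable, subst nn_integral_cmult, use w_meas in measurable,
          simp only: B' w_integral)
    also have "\<dots> = ennreal (t powr s * (B / t powr p + K * A))"
      using B(2) K A(2) by (simp flip: ennreal_mult ennreal_plus)
    finally show ?thesis .
  qed
  have "X \<le> ennreal ((1 + K) * (B / A) powr (s / p) * A)"
  proof (cases "B = 0")
    case True
    \<comment> \<open>The choice \<open>t powr p = B / A\<close> would give \<open>t = 0\<close>, so let \<open>t\<close> tend to \<open>0\<close>.\<close>
    have "X \<le> ennreal e" if "0 < e" for e
    proof -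
      define t where "t = (e / (K * A)) powr (1 / s)"
      have "0 < t" "t powr s = e / (K * A)"
        using that K A s by (simp_all add: t_def powr_powr)
      then show ?thesis
        using X_le[of t] True K A by simp
    qed
    then have "X = 0"
      using ennreal_le_epsilon[of 0 X] by simp
    then show ?thesis
      by simp
  next
    case False
    define t where "t = (B / A) powr (1 / p)"
    have "0 < t" "t powr p = B / A" "t powr s = (B / A) powr (s / p)"
      using False B A s by (simp_all add: t_def powr_powr)
    then show ?thesis
      using X_le[of t] False A by (simp add: algebra_simps)
  qed
  then have "X / ennreal A \<le> ennreal ((1 + K) * (B / A) powr (s / p) * A) / ennreal A"
    by (rule divide_right_mono_ennreal)
  also have "\<dots> = ennreal ((1 + K) * (B / A) powr (s / p))"
    using K A by (subst divide_ennreal) simp_all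
  finally show ?thesis
    by (simp add: average_def X_def A K_def \<beta>_def)
qed

text \<open>For exponents with \<open>s1 + s2 = q\<close> the powers of the area cancel and each term is at most a constant
  times \<open>b powr (q / p)\<close>, where \<open>b\<close> is the weighted integral of \<open>g powr p\<close> over the box. Since
  \<open>b\<close> is at most the full integral \<open>G\<close> and \<open>q \<ge> p\<close>, this is at most
  \<open>G powr (q / p - 1) * b\<close>, and the numbers \<open>b\<close> have a sum of order \<open>G\<close>.\<close>

lemma dyadic_sum_le:
  assumes D: "dyadic_grid \<D>" and \<alpha>: "-1 < \<alpha>"
    and s: "0 < s1" "s1 < p" "0 < s2" "s2 < p" "s1 + s2 = q" "p \<le> q"
  shows "\<exists>C>0. \<forall>g. g \<in> borel_measurable (dA \<alpha>) \<longrightarrow> (\<forall>z. 0 \<le> g z) \<longrightarrow>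
      (\<Sum>\<^sub>\<infinity>I\<in>\<D>. ennpowr (emeasure (dA \<alpha>) (carleson_box I)) (q / p)
          * average \<alpha> (carleson_box I) (\<lambda>z. g z powr s1)
          * average \<alpha> (carleson_box I) (\<lambda>z. g z powr s2))
        \<le> ennreal C * ennpowr (\<integral>\<^sup>+z. ennreal (g z powr p) \<partial>dA \<alpha>) (q / p)"
proof -
  define \<beta>1 where "\<beta>1 = s1 / (p - s1)"
  define \<beta>2 where "\<beta>2 = s2 / (p - s2)"
  \<comment> \<open>Small enough for both negative moments \<open>- \<delta> * \<beta>1\<close> and \<open>- \<delta> * \<beta>2\<close> to be finite.\<close>
  define \<delta> where "\<delta> = (1 + \<alpha>) / (1 + \<beta>1 + \<beta>2)"
  have \<beta>: "0 < \<beta>1" "0 < \<beta>2"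
    using s by (simp_all add: \<beta>1_def \<beta>2_def)
  have "(1 + \<alpha>) * (\<beta>1 / (1 + \<beta>1 + \<beta>2)) < (1 + \<alpha>) * 1"
    "(1 + \<alpha>) * (\<beta>2 / (1 + \<beta>1 + \<beta>2)) < (1 + \<alpha>) * 1"
    using \<alpha> \<beta> by (intro mult_strict_left_mono; simp)+
  then have \<delta>: "0 < \<delta>" "\<delta> * \<beta>1 < 1 + \<alpha>" "\<delta> * \<beta>2 < 1 + \<alpha>"
    using \<alpha> \<beta> by (simp_all add: \<delta>_def)
  define K where "K = (1 + moment_ratio \<alpha> (- (\<delta> * \<beta>1))) * (1 + moment_ratio \<alpha> (- (\<delta> * \<beta>2)))"
  have mr: "0 < moment_ratio \<alpha> (- (\<delta> * \<beta>1))" "0 < moment_ratio \<alpha> (- (\<delta> * \<beta>2))"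
    using \<delta> \<alpha> by (simp_all add: moment_ratio_def box_const_pos)
  then have K: "0 < K"
    by (simp add: K_def)
  define S where "S = 1 / (1 - 2 powr - \<delta>)"
  have S: "0 < S"
    using \<delta> powr_less_mono[of "-\<delta>" 0 "2::real"] by (simp add: S_def)
  show ?thesis
  proof (intro exI[of _ "K * S"] conjI allI impI)
    show "0 < K * S"
      using K S by simp
    fix g :: "complex \<Rightarrow> real"
    assume g [measurable]: "g \<in> borel_measurable (dA \<alpha>)" and g0: "\<forall>z. 0 \<le> g z"
    define G where "G = (\<integral>\<^sup>+z. ennreal (g z powr p) \<partial>dA \<alpha>)"
    show "(\<Sum>\<^sub>\<infinity>I\<in>\<D>. ennpowr (emeasure (dA \<alpha>) (carleson_box I)) (q / p)
          * average \<alpha> (carleson_box I) (\<lambda>z. g z powr s1)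
          * average \<alpha> (carleson_box I) (\<lambda>z. g z powr s2))
        \<le> ennreal (K * S) * ennpowr (\<integral>\<^sup>+z. ennreal (g z powr p) \<partial>dA \<alpha>) (q / p)"
    proof (cases "G = \<infinity>")
      case True
      then show ?thesis
        using K S by (simp add: G_def[symmetric] ennpowr_def ennreal_mult_top)
    next
      case False
      then obtain G' where G': "G = ennreal G'" "0 \<le> G'"
        by (cases G) auto
      define b where "b I = (\<integral>\<^sup>+z\<in>carleson_box I. ennreal ((Im z / ilength I) powr \<delta>) * ennreal (g z powr p) \<partial>dA \<alpha>)"
        for I
      have term_le: "ennpowr (emeasure (dA \<alpha>) (carleson_box I)) (q / p)
            * average \<alpha> (carleson_box I) (\<lambda>z. g z powr s1)
            * average \<alpha> (carleson_box I) (\<lambda>z. g z powr s2)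
          \<le> ennreal (K * G' powr (q / p - 1)) * b I" if I: "I \<in> \<D>" for I
      proof -
        note I' = dyadic_gridD(2,3)[OF D I]
        define A where "A = box_const \<alpha> 0 * ilength I powr (2 + \<alpha>)"
        have A: "emeasure (dA \<alpha>) (carleson_box I) = ennreal A" "0 < A"
          using emeasure_carleson_box[OF I' \<alpha>] box_const_pos[of \<alpha> 0] \<alpha> I' by (simp_all add: A_def)
        have "b I \<le> G"
          unfolding b_def G_def
        proof (rule nn_integral_mono)
          fix z
          show "ennreal ((Im z / ilength I) powr \<delta>) * ennreal (g z powr p) * indicator (carleson_box I) z
              \<le> ennreal (g z powr p)"
          proof (cases "z \<in> carleson_box I")
            case True
            then have "(Im z / ilength I) powr \<delta> \<le> 1"
              using \<delta> by (intro powr_le1) (auto simp: carleson_box_iff)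
            then have "ennreal ((Im z / ilength I) powr \<delta>) * ennreal (g z powr p) \<le> 1 * ennreal (g z powr p)"
              by (intro mult_right_mono) simp_all
            then show ?thesis
              using True by simp
          qed simp
        qed
        then obtain B where B: "b I = ennreal B" "0 \<le> B" "B \<le> G'"
          using G' by (cases "b I") (auto simp: top_unique)
        note av = average_le_weighted_mean[OF I' \<alpha> _ _ \<delta>(1) _ g g0[rule_format] A B(1)[unfolded b_def] B(2)]
        have "ennpowr (emeasure (dA \<alpha>) (carleson_box I)) (q / p)
            * average \<alpha> (carleson_box I) (\<lambda>z. g z powr s1)
            * average \<alpha> (carleson_box I) (\<lambda>z. g z powr s2)
          \<le> ennreal (A powr (q / p))
            * ennreal ((1 + moment_ratio \<alpha> (- (\<delta> * \<beta>1))) * (B / A) powr (s1 / p))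
            * ennreal ((1 + moment_ratio \<alpha> (- (\<delta> * \<beta>2))) * (B / A) powr (s2 / p))"
          unfolding \<beta>1_def \<beta>2_def
          using A(2) \<delta> s by (intro mult_mono av) (simp_all add: A(1) less_imp_le[OF A(2)] ennpowr_ennreal \<beta>1_def \<beta>2_def)
        also have "\<dots> = ennreal (A powr (q / p)
            * ((1 + moment_ratio \<alpha> (- (\<delta> * \<beta>1))) * (B / A) powr (s1 / p))
            * ((1 + moment_ratio \<alpha> (- (\<delta> * \<beta>2))) * (B / A) powr (s2 / p)))"
          using mr by (simp add: ennreal_mult)
        also have "A powr (q / p)
            * ((1 + moment_ratio \<alpha> (- (\<delta> * \<beta>1))) * (B / A) powr (s1 / p))
            * ((1 + moment_ratio \<alpha> (- (\<delta> * \<beta>2))) * (B / A) powr (s2 / p))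
            = K * (A powr (q / p) * ((B / A) powr (s1 / p) * (B / A) powr (s2 / p)))"
          by (simp add: K_def mult_ac)
        also have "(B / A) powr (s1 / p) * (B / A) powr (s2 / p) = (B / A) powr (q / p)"
          by (simp add: s(5)[symmetric] add_divide_distrib powr_add)
        also have "A powr (q / p) * (B / A) powr (q / p) = B powr (q / p)"
          using A B by (simp add: powr_divide)
        also have "B powr (q / p) = B powr (q / p - 1) * B"
          using B powr_add[of B "q / p - 1" 1] by simp
        also have "ennreal (K * (B powr (q / p - 1) * B)) \<le> ennreal (K * (G' powr (q / p - 1) * B))"
          using K B s by (intro ennreal_leI mult_left_mono mult_right_mono powr_mono2) simp_all
        also have "\<dots> = ennreal (K * G' powr (q / p - 1)) * b I"
          using K B by (simp add: ennreal_mult mult.assoc)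
        finally show ?thesis .
      qed
      have "(\<Sum>\<^sub>\<infinity>I\<in>\<D>. ennpowr (emeasure (dA \<alpha>) (carleson_box I)) (q / p)
          * average \<alpha> (carleson_box I) (\<lambda>z. g z powr s1)
          * average \<alpha> (carleson_box I) (\<lambda>z. g z powr s2))
        \<le> (\<Sum>\<^sub>\<infinity>I\<in>\<D>. ennreal (K * G' powr (q / p - 1)) * b I)"
        by (intro infsum_mono nonneg_summable_on_complete term_le) simp_all
      also have "\<dots> = ennreal (K * G' powr (q / p - 1)) * infsum b \<D>"
        by (rule infsum_ennreal_cmult) simp
      also have "\<dots> \<le> ennreal (K * G' powr (q / p - 1)) * (ennreal S * G)"
        unfolding b_def G_def S_def
        by (intro mult_left_mono infsum_weighted_box_integrals_le[OF D \<delta>(1)]) simp_all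
      also have "\<dots> = ennreal (K * S * (G' powr (q / p - 1) * G'))"
        using K S G' by (simp add: mult_ac flip: ennreal_mult)
      also have "G' powr (q / p - 1) * G' = G' powr (q / p)"
        using G' powr_add[of G' "q / p - 1" 1] by simp
      finally show ?thesis
        using K S G' by (simp add: G_def[symmetric] ennpowr_ennreal ennreal_mult)
    qed
  qed
qed

section \<open>Local control of a holomorphic function by its means\<close>

text \<open>Maximise \<open>(R - dist z v) powr (2 / r) * norm (f v)\<close> over the disc and let \<open>w\<close> be a maximum
  point. Near \<open>w\<close>, at the scale \<open>d\<close> of half the distance to the boundary, \<open>norm f\<close> exceeds its value
  at \<open>w\<close> by at most the factor \<open>K\<close>; Cauchy's estimate then bounds \<open>f'\<close>, and \<open>norm f\<close> stays
  above half its value on a disc whose radius \<open>\<rho>\<close> is comparable to \<open>d\<close>. The exponent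
  \<open>2 / r\<close> is the one for which \<open>\<rho>\<^sup>2 * norm (f w) powr r\<close>, of the order of the integral of
  \<open>norm f powr r\<close> over that disc, controls the value at \<open>z\<close>. This covers all \<open>r > 0\<close>
  at once, including \<open>r < 1\<close>, where convexity of the power fails.\<close>

lemma holomorphic_large_disc:
  fixes f :: "complex \<Rightarrow> complex"
  assumes S: "open S" and f: "f holomorphic_on S" and sub: "cball z R \<subseteq> S"
    and R: "0 < R" and r: "0 < r"
  obtains w \<rho> where "0 < \<rho>" "ball w \<rho> \<subseteq> ball z R"
    "\<And>v. v \<in> ball w \<rho> \<Longrightarrow> norm (f w) / 2 \<le> norm (f v)"
    "R powr (2 / r) * norm (f z) \<le> (8 * 2 powr (2 / r) * \<rho>) powr (2 / r) * norm (f w)"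
proof (cases "f z = 0")
  case True
  then show ?thesis
    using R by (intro that[of R z]) auto
next
  case False
  define K where "K = 2 powr (2 / r)"
  define F where "F v = (R - dist z v) powr (2 / r) * norm (f v)" for v
  have K: "1 \<le> K"
    using r by (simp add: K_def ge_one_powr_ge_zero)
  have contf: "continuous_on (cball z R) f"
    using f sub holomorphic_on_imp_continuous_on continuous_on_subset by blast
  have "continuous_on (cball z R) F"
    unfolding F_def using r by (intro continuous_intros contf continuous_on_powr') auto
  then obtain w where w: "w \<in> cball z R" "\<And>v. v \<in> cball z R \<Longrightarrow> F v \<le> F w"
    using continuous_attains_sup[of "cball z R" F] R by auto
  have "0 < F z"
    using False R by (simp add: F_def)
  also have Fzw: "F z \<le> F w"
    using w(2)[of z] R by simp
  finally have "f w \<noteq> 0" "dist z w \<noteq> R"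
    by (auto simp: F_def)
  define d where "d = (R - dist z w) / 2"
  have d: "0 < d"
    using w(1) \<open>dist z w \<noteq> R\<close> by (simp add: d_def)
  have ball_d: "dist z v \<le> R - d" if "dist w v \<le> d" for v
    using dist_triangle[of z v w] that by (simp add: d_def field_simps)
  have bound: "norm (f v) \<le> K * norm (f w)" if v: "dist w v \<le> d" for v
  proof -
    have "d powr (2 / r) * norm (f v) \<le> F v"
      unfolding F_def using ball_d[OF v] d r by (intro mult_right_mono powr_mono2) auto
    also have "\<dots> \<le> F w"
      using w(2)[of v] ball_d[OF v] d by simp
    also have "\<dots> = d powr (2 / r) * (K * norm (f w))"
      using d by (simp add: F_def K_def d_def powr_divide)
    finally show ?thesis
      using d by simp
  qed
  have hol: "f holomorphic_on cball w d"
    using f by (rule holomorphic_on_subset) (use sub ball_d d in force)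
  \<comment> \<open>On the disc of radius \<open>d / 2\<close> the derivative is at most \<open>2 * K * norm (f w) / d\<close>, so over a distance \<open>\<rho>\<close> the value moves by at most \<open>norm (f w) / 2\<close>.\<close>
  define \<rho> where "\<rho> = d / (4 * K)"
  have \<rho>: "0 < \<rho>" "\<rho> \<le> d / 2"
    using d K by (simp_all add: \<rho>_def field_simps)
  have deriv_bound: "norm (deriv f v) \<le> 2 * K * norm (f w) / d" if v: "v \<in> ball w \<rho>" for v
  proof -
    have sub': "cball v (d / 2) \<subseteq> cball w d"
    proof
      fix u assume "u \<in> cball v (d / 2)"
      then show "u \<in> cball w d"
        using dist_triangle[of w u v] v \<rho> by simp
    qed
    have "norm ((deriv ^^ 1) f v) \<le> fact 1 * (K * norm (f w)) / (d / 2) ^ 1"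
    proof (rule Cauchy_inequality)
      show "f holomorphic_on ball v (d / 2)"
        using hol sub' ball_subset_cball holomorphic_on_subset by (metis (no_types, lifting) order_trans)
      show "continuous_on (cball v (d / 2)) f"
        using hol sub' holomorphic_on_imp_continuous_on continuous_on_subset by blast
      show "norm (f u) \<le> K * norm (f w)" if "norm (v - u) = d / 2" for u
        using that sub' by (intro bound) (auto simp: dist_norm subset_iff)
    qed (use d in simp)
    then show ?thesis
      by (simp add: field_simps)
  qed
  have fin: "norm (f w) / 2 \<le> norm (f v)" if v: "v \<in> ball w \<rho>" for v
  proof -
    have "norm (f v - f w) \<le> 2 * K * norm (f w) / d * norm (v - w)"
    proof (rule field_differentiable_bound[of "ball w \<rho>" f "deriv f"])
      show "(f has_field_derivative deriv f u) (at u within ball w \<rho>)" if "u \<in> ball w \<rho>" for u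
      proof (rule holomorphic_derivI)
        show "f holomorphic_on ball w d"
          using hol by (rule holomorphic_on_subset) auto
      qed (use that \<rho> d in auto)
    qed (use deriv_bound v \<rho> in auto)
    also have "\<dots> \<le> 2 * K * norm (f w) / d * \<rho>"
      using v K d by (intro mult_left_mono) (auto simp: dist_norm norm_minus_commute)
    also have "\<dots> = norm (f w) / 2"
      using d K by (simp add: \<rho>_def)
    finally show ?thesis
      using norm_triangle_ineq2[of "f w" "f v"] by (simp add: norm_minus_commute)
  qed
  show ?thesis
  proof (rule that[OF \<rho>(1) _ fin])
    show "ball w \<rho> \<subseteq> ball z R"
    proof
      fix v assume "v \<in> ball w \<rho>"
      then have "dist z v \<le> R - d"
        using \<rho> d by (intro ball_d) auto
      then show "v \<in> ball z R"
        using d by simp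
    qed
    have "8 * 2 powr (2 / r) * \<rho> = R - dist z w"
      using K by (simp add: K_def[symmetric] \<rho>_def d_def)
    then show "R powr (2 / r) * norm (f z) \<le> (8 * 2 powr (2 / r) * \<rho>) powr (2 / r) * norm (f w)"
      using Fzw by (simp add: F_def)
  qed
qed

lemma ball_half_height_Im:
  assumes "v \<in> ball z (Im z / 2)"
  shows "Im z / 2 < Im v" "Im v < 3 / 2 * Im z"
  using assms abs_Im_le_cmod[of "z - v"] by (auto simp: dist_norm)

text \<open>A lower bound for \<open>(\<alpha> + 1) * (2 * Im v / Im z) powr \<alpha>\<close> over the disc of radius
  \<open>Im z / 2\<close> about \<open>z\<close>, on which the base lies between \<open>1\<close> and \<open>3\<close>; the minimum
  covers both signs of \<open>\<alpha>\<close>.\<close>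

definition height_const :: "real \<Rightarrow> real" where
  "height_const \<alpha> = (\<alpha> + 1) * min 1 (3 powr \<alpha>)"

lemma emeasure_dA_disc_ge:
  assumes \<alpha>: "-1 < \<alpha>" and z: "0 < Im z" and \<rho>: "0 < \<rho>" and sub: "ball w \<rho> \<subseteq> ball z (Im z / 2)"
  shows "ennreal (height_const \<alpha> * Im z powr \<alpha> * \<rho>\<^sup>2) \<le> emeasure (dA \<alpha>) (ball w \<rho>)"
proof -
  define m where "m = min 1 (3 powr \<alpha> :: real)"
  define c where "c = 1 / pi * (\<alpha> + 1) * (m * Im z powr \<alpha>)"
  have Im: "Im z / 2 < Im v" "Im v < 3 / 2 * Im z" if "v \<in> ball w \<rho>" for v
    using ball_half_height_Im[of v z] sub that by auto
  have subU: "ball w \<rho> \<subseteq> upper_half_plane"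
    using Im z by (force simp: upper_half_plane_def)
  then have ball: "ball w \<rho> \<in> sets (dA \<alpha>)"
    by (simp add: sets_dA sets_restrict_space_iff)
  have "height_const \<alpha> * Im z powr \<alpha> * \<rho>\<^sup>2 = c * (pi * \<rho>\<^sup>2)"
    by (simp add: c_def m_def height_const_def)
  then have "ennreal (height_const \<alpha> * Im z powr \<alpha> * \<rho>\<^sup>2) = ennreal c * ennreal (pi * \<rho>\<^sup>2)"
    by (simp only: ennreal_mult'' zero_le_power2 mult_nonneg_nonneg pi_ge_zero)
  also have "ennreal (pi * \<rho>\<^sup>2) = emeasure lborel (ball w \<rho>)"
    using \<rho> by (simp add: emeasure_ball unit_ball_vol_2)
  also have "ennreal c * emeasure lborel (ball w \<rho>) = (\<integral>\<^sup>+v. ennreal c * indicator (ball w \<rho>) v \<partial>lborel)"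
    by (simp add: nn_integral_cmult_indicator)
  also have "\<dots> \<le> (\<integral>\<^sup>+v. ennreal (1 / pi * (\<alpha> + 1) * (2 * Im v) powr \<alpha>) * indicator (ball w \<rho>) v
           * indicator upper_half_plane v \<partial>lborel)"
  proof (rule nn_integral_mono)
    fix v
    show "ennreal c * indicator (ball w \<rho>) v
      \<le> ennreal (1 / pi * (\<alpha> + 1) * (2 * Im v) powr \<alpha>) * indicator (ball w \<rho>) v * indicator upper_half_plane v"
    proof (cases "v \<in> ball w \<rho>")
      case True
      have "m * Im z powr \<alpha> \<le> (2 * Im v) powr \<alpha>"
      proof (cases "0 \<le> \<alpha>")
        case True
        then have "Im z powr \<alpha> \<le> (2 * Im v) powr \<alpha>"
          using Im[OF \<open>v \<in> ball w \<rho>\<close>] z by (intro powr_mono2) auto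
        moreover have "m * Im z powr \<alpha> \<le> 1 * Im z powr \<alpha>"
          by (intro mult_right_mono) (simp_all add: m_def)
        ultimately show ?thesis
          by simp
      next
        case False
        then have "(3 * Im z) powr \<alpha> \<le> (2 * Im v) powr \<alpha>"
          using Im[OF \<open>v \<in> ball w \<rho>\<close>] z by (intro powr_mono2') auto
        moreover have "m * Im z powr \<alpha> \<le> (3 * Im z) powr \<alpha>"
          using z by (simp add: powr_mult m_def mult_right_mono)
        ultimately show ?thesis
          by (rule order_trans[rotated])
      qed
      then have "c \<le> 1 / pi * (\<alpha> + 1) * (2 * Im v) powr \<alpha>"
        unfolding c_def using \<alpha> by (intro mult_left_mono) auto
      then show ?thesis
        using True subU by (auto intro!: ennreal_leI)
    qed simp
  qed
  also have "\<dots> = (\<integral>\<^sup>+v. indicator (ball w \<rho>) v \<partial>dA \<alpha>)"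
    using ball by (subst nn_integral_dA) simp_all
  also have "\<dots> = emeasure (dA \<alpha>) (ball w \<rho>)"
    using ball by simp
  finally show ?thesis .
qed

definition sub_mean_const :: "real \<Rightarrow> real \<Rightarrow> real" where
  "sub_mean_const \<alpha> r = 256 * (2 powr (2 / r))\<^sup>2 * 2 powr r / height_const \<alpha>"

lemma sub_mean_const_pos: "-1 < \<alpha> \<Longrightarrow> 0 < sub_mean_const \<alpha> r"
  by (simp add: sub_mean_const_def height_const_def)

text \<open>The sub-mean value property up to a constant: the disc on which \<open>norm f\<close> is large contributes
  enough to the integral. The disc of radius \<open>Im z / 2\<close> stays away from the real line, where the
  density may vanish or blow up.\<close>

lemma norm_powr_le_local_integral:
  fixes f :: "complex \<Rightarrow> complex"
  assumes \<alpha>: "-1 < \<alpha>" and r: "0 < r" and f: "f holomorphic_on upper_half_plane" and z: "0 < Im z"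
  shows "ennreal (norm (f z) powr r * Im z powr (2 + \<alpha>))
           \<le> ennreal (sub_mean_const \<alpha> r)
             * (\<integral>\<^sup>+v\<in>ball z (Im z / 2). ennreal (norm (f v) powr r) \<partial>dA \<alpha>)"
proof -
  define K where "K = 2 powr (2 / r)"
  define h where "h = height_const \<alpha>"
  define y where "y = Im z"
  have h: "0 < h" and K: "0 < K" and y: "0 < y"
    using \<alpha> z by (simp_all add: h_def height_const_def K_def y_def)
  have "cball z (y / 2) \<subseteq> upper_half_plane"
  proof
    fix v assume "v \<in> cball z (y / 2)"
    then show "v \<in> upper_half_plane"
      using abs_Im_le_cmod[of "z - v"] z by (auto simp: dist_norm upper_half_plane_def y_def)
  qed
  then obtain w \<rho> where \<rho>: "0 < \<rho>" and sub: "ball w \<rho> \<subseteq> ball z (y / 2)"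
    and low: "\<And>v. v \<in> ball w \<rho> \<Longrightarrow> norm (f w) / 2 \<le> norm (f v)"
    and "(y / 2) powr (2 / r) * norm (f z) \<le> (8 * 2 powr (2 / r) * \<rho>) powr (2 / r) * norm (f w)"
    by (rule holomorphic_large_disc[OF open_upper_half_plane f _ half_gt_zero[OF y] r]) blast
  then have high: "(y / 2) powr (2 / r) * norm (f z) \<le> (8 * K * \<rho>) powr (2 / r) * norm (f w)"
    by (simp add: K_def)
  define M where "M = (norm (f w) / 2) powr r"
  have "((y / 2) powr (2 / r) * norm (f z)) powr r \<le> ((8 * K * \<rho>) powr (2 / r) * norm (f w)) powr r"
    using high r y by (intro powr_mono2) auto
  then have "(y / 2)\<^sup>2 * norm (f z) powr r \<le> (8 * K * \<rho>)\<^sup>2 * norm (f w) powr r"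
    using r y K \<rho> by (simp add: powr_mult powr_powr flip: powr_numeral)
  moreover have "norm (f w) powr r = 2 powr r * M"
    by (simp add: M_def powr_divide)
  ultimately have "norm (f z) powr r * y\<^sup>2 \<le> 256 * K\<^sup>2 * 2 powr r * (\<rho>\<^sup>2 * M)"
    by (simp add: power_mult_distrib power_divide algebra_simps)
  then have "norm (f z) powr r * y\<^sup>2 * y powr \<alpha> \<le> 256 * K\<^sup>2 * 2 powr r * (\<rho>\<^sup>2 * M) * y powr \<alpha>"
    by (rule mult_right_mono) simp
  also have "\<dots> = sub_mean_const \<alpha> r * (M * (h * y powr \<alpha> * \<rho>\<^sup>2))"
    using h by (simp add: sub_mean_const_def K_def h_def)
  finally have "norm (f z) powr r * y powr (2 + \<alpha>) \<le> sub_mean_const \<alpha> r * (M * (h * y powr \<alpha> * \<rho>\<^sup>2))"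
    using y by (simp add: powr_add mult.assoc)
  then have "ennreal (norm (f z) powr r * y powr (2 + \<alpha>))
      \<le> ennreal (sub_mean_const \<alpha> r * (M * (h * y powr \<alpha> * \<rho>\<^sup>2)))"
    by (rule ennreal_leI)
  also have "\<dots> = ennreal (sub_mean_const \<alpha> r) * (ennreal M * ennreal (h * y powr \<alpha> * \<rho>\<^sup>2))"
    using sub_mean_const_pos[OF \<alpha>, of r] h by (simp add: ennreal_mult M_def)
  also have "\<dots> \<le> ennreal (sub_mean_const \<alpha> r) * (ennreal M * emeasure (dA \<alpha>) (ball w \<rho>))"
    using emeasure_dA_disc_ge[OF \<alpha> z \<rho>, of w] sub
    by (intro mult_left_mono) (simp_all add: y_def h_def)
  also have "ennreal M * emeasure (dA \<alpha>) (ball w \<rho>) = (\<integral>\<^sup>+v. ennreal M * indicator (ball w \<rho>) v \<partial>dA \<alpha>)"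
  proof (rule nn_integral_cmult_indicator[symmetric])
    have "ball w \<rho> \<subseteq> upper_half_plane"
      using sub ball_half_height_Im[of _ z] z by (force simp: upper_half_plane_def y_def)
    then show "ball w \<rho> \<in> sets (dA \<alpha>)"
      by (simp add: sets_dA sets_restrict_space_iff)
  qed
  also have "\<dots> \<le> (\<integral>\<^sup>+v\<in>ball z (Im z / 2). ennreal (norm (f v) powr r) \<partial>dA \<alpha>)"
  proof (rule nn_integral_mono)
    fix v
    show "ennreal M * indicator (ball w \<rho>) v
        \<le> ennreal (norm (f v) powr r) * indicator (ball z (Im z / 2)) v"
    proof (cases "v \<in> ball w \<rho>")
      case True
      then have "M \<le> norm (f v) powr r" "v \<in> ball z (Im z / 2)"
        unfolding M_def using low r sub by (auto intro!: powr_mono2 simp: y_def)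
      then show ?thesis
        using True by (simp add: ennreal_leI)
    qed simp
  qed
  finally show ?thesis
    by (simp add: y_def mult_left_mono)
qed

text \<open>If a box contains that disc and is not much larger, the mean over the box controls the value at
  \<open>z\<close> as well.\<close>

lemma norm_powr_le_average:
  fixes f :: "complex \<Rightarrow> complex"
  assumes \<alpha>: "-1 < \<alpha>" and r: "0 < r" and f: "f holomorphic_on upper_half_plane" and z: "0 < Im z"
    and J: "J \<in> sets borel" "0 < ilength J" "ilength J \<le> c * Im z"
    and sub: "ball z (Im z / 2) \<subseteq> carleson_box J"
  shows "ennreal (norm (f z) powr r)
           \<le> ennreal (sub_mean_const \<alpha> r * box_const \<alpha> 0 * c powr (2 + \<alpha>))
             * average \<alpha> (carleson_box J) (\<lambda>v. norm (f v) powr r)"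
proof -
  define y where "y = Im z"
  define s where "s = sub_mean_const \<alpha> r"
  define b where "b = box_const \<alpha> 0"
  define A where "A = b * ilength J powr (2 + \<alpha>)"
  define X where "X = (\<integral>\<^sup>+v\<in>carleson_box J. ennreal (norm (f v) powr r) \<partial>dA \<alpha>)"
  have y: "0 < y" and s: "0 < s" and b: "0 < b"
    using z sub_mean_const_pos[OF \<alpha>] box_const_pos[of \<alpha> 0] \<alpha> by (simp_all add: y_def s_def b_def)
  have c: "0 < c"
    using J y by (metis order.strict_trans2 y_def zero_less_mult_pos2)
  have A: "emeasure (dA \<alpha>) (carleson_box J) = ennreal A" "0 < A"
    using emeasure_carleson_box[OF J(1,2) \<alpha>] b J by (simp_all add: A_def b_def)
  have "A \<le> b * (c * y) powr (2 + \<alpha>)"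
    unfolding A_def using b J \<alpha> by (intro mult_left_mono powr_mono2) (auto simp: y_def)
  also have "\<dots> = b * c powr (2 + \<alpha>) * y powr (2 + \<alpha>)"
    using c y by (simp add: powr_mult)
  finally have A_le: "A \<le> b * c powr (2 + \<alpha>) * y powr (2 + \<alpha>)" .
  have "ennreal (norm (f z) powr r * y powr (2 + \<alpha>)) \<le> ennreal s * X"
  proof -
    have "(\<integral>\<^sup>+v\<in>ball z (Im z / 2). ennreal (norm (f v) powr r) \<partial>dA \<alpha>) \<le> X"
      unfolding X_def using sub by (intro nn_integral_mono) (auto simp: indicator_def)
    then show ?thesis
      using norm_powr_le_local_integral[OF \<alpha> r f z] unfolding y_def s_def
      by (meson mult_left_mono order_trans zero_le)
  qed
  also have "X = X / ennreal A * ennreal A"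
    using A by (simp add: ennreal_divide_times ennreal_times_divide flip: divide_ennreal)
  also have "ennreal s * (X / ennreal A * ennreal A)
      \<le> ennreal s * (X / ennreal A * ennreal (b * c powr (2 + \<alpha>) * y powr (2 + \<alpha>)))"
    using A_le by (intro mult_left_mono ennreal_leI) simp_all
  finally have "ennreal (norm (f z) powr r * y powr (2 + \<alpha>))
      \<le> ennreal s * (X / ennreal A * ennreal (b * c powr (2 + \<alpha>) * y powr (2 + \<alpha>)))" .
  then have "ennreal (norm (f z) powr r * y powr (2 + \<alpha>)) * ennreal (1 / y powr (2 + \<alpha>))
      \<le> ennreal s * (X / ennreal A * ennreal (b * c powr (2 + \<alpha>) * y powr (2 + \<alpha>))) * ennreal (1 / y powr (2 + \<alpha>))"
    by (rule mult_right_mono) simp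
  also have "ennreal (norm (f z) powr r * y powr (2 + \<alpha>)) * ennreal (1 / y powr (2 + \<alpha>)) = ennreal (norm (f z) powr r)"
    using y by (simp flip: ennreal_mult)
  also have "ennreal s * (X / ennreal A * ennreal (b * c powr (2 + \<alpha>) * y powr (2 + \<alpha>))) * ennreal (1 / y powr (2 + \<alpha>))
      = (X / ennreal A) * (ennreal s * ennreal (b * c powr (2 + \<alpha>) * y powr (2 + \<alpha>)) * ennreal (1 / y powr (2 + \<alpha>)))"
    by (simp only: mult_ac)
  also have "ennreal s * ennreal (b * c powr (2 + \<alpha>) * y powr (2 + \<alpha>)) * ennreal (1 / y powr (2 + \<alpha>))
      = ennreal (s * b * c powr (2 + \<alpha>))"
    using y s b by (simp flip: ennreal_mult)
  finally show ?thesis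
    by (simp add: average_def A X_def s_def b_def mult.commute)
qed

section \<open>Boundedness forces a Carleson condition\<close>

definition kernel_pole :: "real \<Rightarrow> real \<Rightarrow> complex" where
  "kernel_pole c l = Complex c (- l)"

text \<open>These functions test boundedness on the box over an interval of length \<open>l\<close> around \<open>c\<close>: their
  modulus is of order \<open>l powr - n\<close> on the box, while for large \<open>n\<close> their norm is of the same order as
  the contribution of the box to it.\<close>

definition test_kernel :: "real \<Rightarrow> real \<Rightarrow> nat \<Rightarrow> complex \<Rightarrow> complex" where
  "test_kernel c l n z = 1 / (z - kernel_pole c l) ^ n"

lemma kernel_pole_dist:
  assumes "z \<in> upper_half_plane" "0 < l"
  shows "\<bar>Re z - c\<bar> \<le> norm (z - kernel_pole c l)" "Im z + l \<le> norm (z - kernel_pole c l)"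
    "norm (z - kernel_pole c l) \<le> \<bar>Re z - c\<bar> + (Im z + l)"
  using assms abs_Re_le_cmod[of "z - kernel_pole c l"] abs_Im_le_cmod[of "z - kernel_pole c l"]
    cmod_le[of "z - kernel_pole c l"]
  by (auto simp: kernel_pole_def upper_half_plane_def)

lemma kernel_pole_dist_pos:
  assumes "z \<in> upper_half_plane" "0 < l"
  shows "0 < norm (z - kernel_pole c l)"
  by (rule order.strict_trans2[OF _ kernel_pole_dist(2)[OF assms]])
     (use assms in \<open>simp add: upper_half_plane_def\<close>)

lemma test_kernel_holomorphic:
  assumes "0 < l"
  shows "test_kernel c l n holomorphic_on upper_half_plane"
proof -
  have "z - kernel_pole c l \<noteq> 0" if "z \<in> upper_half_plane" for z
    using kernel_pole_dist_pos[OF that assms] by (metis norm_zero less_irrefl)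
  then show ?thesis
    unfolding test_kernel_def by (auto intro!: holomorphic_intros)
qed

lemma norm_test_kernel_powr:
  assumes "z \<in> upper_half_plane" "0 < l"
  shows "norm (test_kernel c l n z) powr p = norm (z - kernel_pole c l) powr - (real n * p)"
  using kernel_pole_dist_pos[OF assms, of c]
  by (simp add: test_kernel_def norm_divide norm_power powr_divide powr_powr powr_minus_divide
      flip: powr_realpow)

definition kernel_const :: "real \<Rightarrow> real \<Rightarrow> real" where
  "kernel_const \<alpha> m = 4 powr m * box_const \<alpha> 0 / (1 - 2 powr (2 + \<alpha> - m))"

lemma kernel_const_pos:
  assumes "-1 < \<alpha>" "2 + \<alpha> < m"
  shows "0 < kernel_const \<alpha> m"
  using assms box_const_pos[of \<alpha> 0] powr_less_mono[of "2 + \<alpha> - m" 0 "2::real"]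
  by (simp add: kernel_const_def)

text \<open>The concentric boxes of side \<open>2 ^ k * l\<close> exhaust the half plane, and a point that first enters at
  stage \<open>k\<close> has distance of order \<open>2 ^ k * l\<close> from the pole. So the integral is dominated by a
  geometric series of ratio \<open>2 powr (2 + \<alpha> - n * p)\<close>.\<close>

lemma test_kernel_integral_le:
  assumes \<alpha>: "-1 < \<alpha>" and l: "0 < l" and m: "2 + \<alpha> < real n * p"
  shows "(\<integral>\<^sup>+z. ennreal (norm (test_kernel c l n z) powr p) \<partial>dA \<alpha>)
           \<le> ennreal (kernel_const \<alpha> (real n * p) * l powr (2 + \<alpha> - real n * p))"
proof -
  define m where "m = real n * p"
  define Q where "Q k = carleson_box {c - 2 ^ k * l / 2..c + 2 ^ k * l / 2}" for k :: nat
  define a where "a k = (2 ^ k * l / 4) powr - m" for k :: nat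
  define b where "b = box_const \<alpha> 0"
  define r where "r = 2 powr (2 + \<alpha> - m)"
  have m: "2 + \<alpha> < m" "0 < m" and b: "0 < b"
    using m \<alpha> box_const_pos[of \<alpha> 0] by (simp_all add: m_def b_def)
  have r: "0 < r" "r < 1"
    using m powr_less_mono[of "2 + \<alpha> - m" 0 "2::real"] by (simp_all add: r_def)
  have len: "ilength {c - 2 ^ k * l / 2..c + 2 ^ k * l / 2} = 2 ^ k * l" for k
    using l by (simp add: ilength_def)
  have Q: "Q k \<in> sets (dA \<alpha>)" "emeasure (dA \<alpha>) (Q k) = ennreal (b * (2 ^ k * l) powr (2 + \<alpha>))" for k
    unfolding Q_def b_def using emeasure_carleson_box[OF _ _ \<alpha>, of "{c - 2 ^ k * l / 2..c + 2 ^ k * l / 2}"] len l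
    by (simp_all add: carleson_box_sets_dA)
  have pointwise: "ennreal (norm (test_kernel c l n z) powr p) \<le> (\<Sum>k. ennreal (a k) * indicator (Q k) z)"
    if z: "z \<in> upper_half_plane" for z
  proof -
    define R where "R = norm (z - kernel_pole c l)"
    define P where "P k \<longleftrightarrow> R \<le> 2 ^ k * l / 2" for k :: nat
    have y: "0 < Im z"
      using z by (simp add: upper_half_plane_def)
    have R: "\<bar>Re z - c\<bar> \<le> R" "Im z + l \<le> R"
      using kernel_pole_dist[OF z l] by (simp_all add: R_def)
    obtain k0 :: nat where "2 * R / l < 2 ^ k0"
      using real_arch_pow[of 2 "2 * R / l"] by auto
    then have "P k0"
      using l by (simp add: P_def field_simps)
    \<comment> \<open>Minimality at \<open>k\<close> gives the lower bound \<open>2 ^ k * l / 4 < R\<close>; it needs \<open>k > 0\<close>, which holds because \<open>R\<close> exceeds \<open>l\<close>.\<close>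
    define k where "k = (LEAST k. P k)"
    have Pk: "P k"
      unfolding k_def using \<open>P k0\<close> by (rule LeastI)
    have "\<not> P 0"
      using R y l by (simp add: P_def)
    then have "k \<noteq> 0"
      using Pk by metis
    then obtain j where j: "k = Suc j"
      using not0_implies_Suc by blast
    have "\<not> P j"
      using not_less_Least[of j P] j by (simp add: k_def[symmetric])
    moreover have "2 ^ k * l = 2 * (2 ^ j * l)"
      by (simp add: j)
    ultimately have "2 ^ k * l / 4 \<le> R"
      unfolding P_def by linarith
    then have "R powr - m \<le> a k"
      unfolding a_def using l m by (intro powr_mono2') auto
    moreover have "z \<in> Q k"
      using Pk R y l by (auto simp: Q_def carleson_box_iff len P_def abs_le_iff)
    ultimately have "ennreal (norm (test_kernel c l n z) powr p) \<le> ennreal (a k) * indicator (Q k) z"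
      using norm_test_kernel_powr[OF z l] by (simp add: R_def m_def ennreal_leI)
    also have "\<dots> \<le> (\<Sum>k. ennreal (a k) * indicator (Q k) z)"
    proof -
      have "F k \<le> suminf F" for F :: "nat \<Rightarrow> ennreal"
        using sum_le_suminf[of F "{k}"] by simp
      then show ?thesis .
    qed
    finally show ?thesis .
  qed
  have "(\<integral>\<^sup>+z. ennreal (norm (test_kernel c l n z) powr p) \<partial>dA \<alpha>)
      \<le> (\<integral>\<^sup>+z. (\<Sum>k. ennreal (a k) * indicator (Q k) z) \<partial>dA \<alpha>)"
    by (rule nn_integral_mono) (simp add: pointwise)
  also have "\<dots> = (\<Sum>k. \<integral>\<^sup>+z. ennreal (a k) * indicator (Q k) z \<partial>dA \<alpha>)"
    using Q(1) by (intro nn_integral_suminf) simp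
  also have "\<dots> = (\<Sum>k. ennreal (4 powr m * b * l powr (2 + \<alpha> - m) * r ^ k))"
  proof (rule arg_cong[where f = suminf], rule ext)
    fix k
    have "a k * (b * (2 ^ k * l) powr (2 + \<alpha>)) = 4 powr m * b * l powr (2 + \<alpha> - m) * r ^ k"
    proof -
      have "a k = 4 powr m * (2 ^ k * l) powr - m"
        using l by (simp add: a_def powr_divide powr_minus_divide)
      then have "a k * (b * (2 ^ k * l) powr (2 + \<alpha>)) = 4 powr m * b * (2 ^ k * l) powr (2 + \<alpha> - m)"
        using l by (simp add: powr_diff powr_minus_divide)
      also have "(2 ^ k * l) powr (2 + \<alpha> - m) = l powr (2 + \<alpha> - m) * r ^ k"
        using l by (simp add: powr_mult r_def powr_powr mult.commute flip: powr_realpow)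
      finally show ?thesis
        by simp
    qed
    moreover have "(\<integral>\<^sup>+z. ennreal (a k) * indicator (Q k) z \<partial>dA \<alpha>)
        = ennreal (a k * (b * (2 ^ k * l) powr (2 + \<alpha>)))"
      unfolding nn_integral_cmult_indicator[OF Q(1)] Q(2)
      by (rule ennreal_mult'[symmetric]) (simp add: a_def)
    ultimately show "(\<integral>\<^sup>+z. ennreal (a k) * indicator (Q k) z \<partial>dA \<alpha>)
        = ennreal (4 powr m * b * l powr (2 + \<alpha> - m) * r ^ k)"
      by (simp only:)
  qed
  also have "\<dots> = ennreal (\<Sum>k. 4 powr m * b * l powr (2 + \<alpha> - m) * r ^ k)"
    using r b by (intro suminf_ennreal2 summable_mult summable_geometric) auto
  also have "(\<Sum>k. 4 powr m * b * l powr (2 + \<alpha> - m) * r ^ k) = kernel_const \<alpha> m * l powr (2 + \<alpha> - m)"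
    using r by (simp add: suminf_mult suminf_geometric summable_geometric kernel_const_def r_def b_def)
  finally show ?thesis
    by (simp add: m_def)
qed

text \<open>The left hand side is the mass that the image under \<open>\<phi>\<close> of the measure
  \<open>norm u powr q\<close> times \<open>dA\<close> gives to a box. The bound results from applying
  boundedness to a test function adapted to the box; all powers of the side length except
  \<open>l powr ((2 + \<alpha>) * q / p)\<close> cancel.\<close>

lemma bounded_imp_carleson_measure:
  assumes \<alpha>: "-1 < \<alpha>" and p: "0 < p" and q: "0 < q"
    and u: "u holomorphic_on upper_half_plane"
    and \<phi>: "\<phi> holomorphic_on upper_half_plane" "\<phi> ` upper_half_plane \<subseteq> upper_half_plane"
    and bdd: "bergman_bounded \<alpha> p q (weighted_comp u \<phi>)"
  shows "\<exists>C>0. \<forall>I. is_interval I \<and> 0 < ilength I \<longrightarrow>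
      (\<integral>\<^sup>+z. ennreal (norm (u z) powr q) * indicator (carleson_box I) (\<phi> z) \<partial>dA \<alpha>)
        \<le> ennreal C * ennpowr (emeasure (dA \<alpha>) (carleson_box I)) (q / p)"
proof -
  obtain C0 where C0: "\<And>f. f \<in> bergman_space p \<alpha> \<Longrightarrow>
      bergman_norm q \<alpha> (weighted_comp u \<phi> f) \<le> ennreal C0 * bergman_norm p \<alpha> f"
    using bdd unfolding bergman_bounded_def by blast
  define C1 where "C1 = max C0 1"
  have C1: "0 < C1"
    by (simp add: C1_def)
  \<comment> \<open>Large enough for the test functions to lie in the space.\<close>
  obtain n :: nat where "(2 + \<alpha>) / p < real n"
    using reals_Archimedean2 by blast
  then have n: "2 + \<alpha> < real n * p"
    using p by (simp add: field_simps)
  define T where "T = kernel_const \<alpha> (real n * p)"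
  define b where "b = box_const \<alpha> 0"
  have T: "0 < T" and b: "0 < b"
    using kernel_const_pos[OF \<alpha> n] box_const_pos[of \<alpha> 0] \<alpha> by (simp_all add: T_def b_def)
  define C where "C = C1 powr q * (T / b) powr (q / p) * 3 powr (real n * q)"
  show ?thesis
  proof (intro exI[of _ C] conjI allI impI)
    show "0 < C"
      using C1 T b by (simp add: C_def)
    fix I assume I: "is_interval I \<and> 0 < ilength I"
    define l where "l = ilength I"
    have l: "0 < l"
      using I by (simp add: l_def)
    have borel: "I \<in> sets borel"
      using I real_interval_borel_measurable by blast
    have "I \<noteq> {}"
      using I by (auto simp: ilength_def)
    then obtain c where c: "c \<in> I"
      by blast
    define f where "f = test_kernel c l n"
    define X where "X = (\<integral>\<^sup>+z. ennreal (norm (u z) powr q) * indicator (carleson_box I) (\<phi> z) \<partial>dA \<alpha>)"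
    have f_int: "(\<integral>\<^sup>+z. ennreal (norm (f z) powr p) \<partial>dA \<alpha>) \<le> ennreal (T * l powr (2 + \<alpha> - real n * p))"
      unfolding f_def T_def by (rule test_kernel_integral_le[OF \<alpha> l n])
    then have "(\<integral>\<^sup>+z. ennreal (norm (f z) powr p) \<partial>dA \<alpha>) < \<infinity>"
      by (rule order.strict_trans1) simp
    then have "f \<in> bergman_space p \<alpha>"
      using test_kernel_holomorphic[OF l]
      by (simp add: bergman_space_def bergman_norm_def ennpowr_less_top[simplified] f_def)
    then have "bergman_norm q \<alpha> (weighted_comp u \<phi> f) \<le> ennreal C1 * bergman_norm p \<alpha> f"
      using C0[of f] mult_right_mono[of "ennreal C0" "ennreal C1" "bergman_norm p \<alpha> f"]
      by (simp add: C1_def ennreal_leI)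
    then have "ennpowr (bergman_norm q \<alpha> (weighted_comp u \<phi> f)) q \<le> ennpowr (ennreal C1 * bergman_norm p \<alpha> f) q"
      using q by (intro ennpowr_mono) simp_all
    also have "\<dots> = ennreal (C1 powr q) * ennpowr (\<integral>\<^sup>+z. ennreal (norm (f z) powr p) \<partial>dA \<alpha>) (q / p)"
      by (simp add: ennpowr_cmult[OF C1] bergman_norm_powr)
    also have "\<dots> \<le> ennreal (C1 powr q) * ennpowr (ennreal (T * l powr (2 + \<alpha> - real n * p))) (q / p)"
      using p q f_int by (intro mult_left_mono ennpowr_mono) simp_all
    also have "\<dots> = ennreal (C1 powr q) * ennreal ((T * l powr (2 + \<alpha> - real n * p)) powr (q / p))"
      using T by (subst ennpowr_ennreal) simp_all
    also have "\<dots> = ennreal (C1 powr q * (T * l powr (2 + \<alpha> - real n * p)) powr (q / p))"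
      by (rule ennreal_mult'[symmetric]) simp
    finally have upper: "(\<integral>\<^sup>+z. ennreal (norm (u z * f (\<phi> z)) powr q) \<partial>dA \<alpha>)
        \<le> ennreal (C1 powr q * (T * l powr (2 + \<alpha> - real n * p)) powr (q / p))"
      using q by (simp add: bergman_norm_powr_same weighted_comp_def)
    have "ennreal ((3 * l) powr - (real n * q)) * X
        = (\<integral>\<^sup>+z. ennreal ((3 * l) powr - (real n * q)) *
            (ennreal (norm (u z) powr q) * indicator (carleson_box I) (\<phi> z)) \<partial>dA \<alpha>)"
    proof -
      have [measurable]: "(\<lambda>z. ennreal (norm (u z) powr q)) \<in> borel_measurable (dA \<alpha>)"
        "\<phi> \<in> borel_measurable (dA \<alpha>)"
        using continuous_on_measurable_dA[of u \<alpha>] continuous_on_measurable_dA[of \<phi> \<alpha>]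
          holomorphic_on_imp_continuous_on u \<phi>(1) by auto
      note [measurable] = carleson_box_borel[OF borel]
      show ?thesis
        unfolding X_def by (rule nn_integral_cmult[symmetric]) measurable
    qed
    also have "\<dots> \<le> (\<integral>\<^sup>+z. ennreal (norm (u z * f (\<phi> z)) powr q) \<partial>dA \<alpha>)"
    proof (rule nn_integral_mono)
      fix z assume "z \<in> space (dA \<alpha>)"
      then have \<phi>z: "\<phi> z \<in> upper_half_plane"
        using \<phi>(2) by auto
      show "ennreal ((3 * l) powr - (real n * q)) *
            (ennreal (norm (u z) powr q) * indicator (carleson_box I) (\<phi> z))
          \<le> ennreal (norm (u z * f (\<phi> z)) powr q)"
      proof (cases "\<phi> z \<in> carleson_box I")
        case True
        have "norm (\<phi> z - kernel_pole c l) \<le> 3 * l" "0 < norm (\<phi> z - kernel_pole c l)"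
          using kernel_pole_dist(2,3)[OF \<phi>z l, of c] True c l
            dist_le_ilength[OF conjunct1[OF I] conjunct2[OF I], of "Re (\<phi> z)" c]
          by (auto simp: carleson_box_iff l_def)
        then have "(3 * l) powr - (real n * q) \<le> norm (f (\<phi> z)) powr q"
          unfolding f_def norm_test_kernel_powr[OF \<phi>z l] using q by (intro powr_mono2') auto
        then have "(3 * l) powr - (real n * q) * norm (u z) powr q \<le> norm (u z * f (\<phi> z)) powr q"
          by (simp add: norm_mult powr_mult mult.commute mult_left_mono)
        then show ?thesis
          using True by (simp add: ennreal_leI flip: ennreal_mult)
      qed simp
    qed
    also note upper
    finally have "ennreal ((3 * l) powr (real n * q)) * (ennreal ((3 * l) powr - (real n * q)) * X)
        \<le> ennreal ((3 * l) powr (real n * q)) * ennreal (C1 powr q * (T * l powr (2 + \<alpha> - real n * p)) powr (q / p))"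
      by (rule mult_left_mono) simp
    also have "ennreal ((3 * l) powr (real n * q)) * (ennreal ((3 * l) powr - (real n * q)) * X) = X"
      using l by (simp add: powr_minus flip: mult.assoc ennreal_mult)
    also have "ennreal ((3 * l) powr (real n * q)) * ennreal (C1 powr q * (T * l powr (2 + \<alpha> - real n * p)) powr (q / p))
        = ennreal (C * (b * l powr (2 + \<alpha>)) powr (q / p))"
    proof -
      have "(l powr (2 + \<alpha> - real n * p)) powr (q / p) * l powr (real n * q) = (l powr (2 + \<alpha>)) powr (q / p)"
        using p by (simp add: powr_powr field_simps flip: powr_add)
      then have "(3 * l) powr (real n * q) * (C1 powr q * (T * l powr (2 + \<alpha> - real n * p)) powr (q / p))
          = C1 powr q * T powr (q / p) * 3 powr (real n * q) * (l powr (2 + \<alpha>)) powr (q / p)"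
        using l T by (simp add: powr_mult mult_ac)
      also have "\<dots> = C * (b * l powr (2 + \<alpha>)) powr (q / p)"
        using b T by (simp add: C_def powr_mult powr_divide)
      finally show ?thesis
        by (simp flip: ennreal_mult)
    qed
    also have "\<dots> = ennreal C * ennreal ((b * l powr (2 + \<alpha>)) powr (q / p))"
      by (rule ennreal_mult'') simp
    also have "\<dots> = ennreal C * ennpowr (emeasure (dA \<alpha>) (carleson_box I)) (q / p)"
      using emeasure_carleson_box[OF borel conjunct2[OF I] \<alpha>] ennpowr_ennreal[of "b * l powr (2 + \<alpha>)" "q / p"] b
      unfolding l_def b_def by simp
    finally show "(\<integral>\<^sup>+z. ennreal (norm (u z) powr q) * indicator (carleson_box I) (\<phi> z) \<partial>dA \<alpha>)
        \<le> ennreal C * ennpowr (emeasure (dA \<alpha>) (carleson_box I)) (q / p)"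
      by (simp add: X_def)
  qed
qed

section \<open>The equivalence\<close>

lemma dyadic_sums_bounded:
  assumes D: "\<And>i. i \<in> {1..3} \<Longrightarrow> dyadic_grid (\<D> i)" and \<alpha>: "-1 < \<alpha>"
    and s: "0 < s1" "s1 < p" "0 < s2" "s2 < p" "s1 + s2 = q" "p \<le> q"
  shows "\<exists>C>0. \<forall>f\<in>bergman_space p \<alpha>.
      (\<Sum>i=1..3::nat. \<Sum>\<^sub>\<infinity>I\<in>\<D> i. ennpowr (emeasure (dA \<alpha>) (carleson_box I)) (q / p)
          * average \<alpha> (carleson_box I) (\<lambda>z. norm (f z) powr s1)
          * average \<alpha> (carleson_box I) (\<lambda>z. norm (f z) powr s2))
        \<le> ennreal C * ennpowr (bergman_norm p \<alpha> f) q"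
proof -
  define P where "P i C \<longleftrightarrow> 0 < C \<and> (\<forall>g. g \<in> borel_measurable (dA \<alpha>) \<longrightarrow> (\<forall>z. 0 \<le> g z) \<longrightarrow>
      (\<Sum>\<^sub>\<infinity>I\<in>\<D> i. ennpowr (emeasure (dA \<alpha>) (carleson_box I)) (q / p)
          * average \<alpha> (carleson_box I) (\<lambda>z. g z powr s1)
          * average \<alpha> (carleson_box I) (\<lambda>z. g z powr s2))
        \<le> ennreal C * ennpowr (\<integral>\<^sup>+z. ennreal (g z powr p) \<partial>dA \<alpha>) (q / p))" for i C
  have "\<exists>C. P i C" if "i \<in> {1..3}" for i
    using dyadic_sum_le[OF D[OF that] \<alpha> s] by (simp add: P_def)
  then obtain C where C: "\<And>i. i \<in> {1..3} \<Longrightarrow> P i (C i)"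
    by metis
  show ?thesis
  proof (intro exI[of _ "\<Sum>i=1..3. C i"] conjI ballI)
    show "0 < (\<Sum>i=1..3. C i)"
      using C by (intro sum_pos) (auto simp: P_def)
    fix f assume f: "f \<in> bergman_space p \<alpha>"
    then have "(\<lambda>z. norm (f z)) \<in> borel_measurable (dA \<alpha>)"
      by (intro continuous_on_measurable_dA continuous_on_norm holomorphic_on_imp_continuous_on)
         (simp add: bergman_space_def)
    then have "(\<Sum>i=1..3::nat. \<Sum>\<^sub>\<infinity>I\<in>\<D> i. ennpowr (emeasure (dA \<alpha>) (carleson_box I)) (q / p)
          * average \<alpha> (carleson_box I) (\<lambda>z. norm (f z) powr s1)
          * average \<alpha> (carleson_box I) (\<lambda>z. norm (f z) powr s2))
        \<le> (\<Sum>i=1..3. ennreal (C i) * ennpowr (bergman_norm p \<alpha> f) q)"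
      using C by (intro sum_mono) (simp add: P_def bergman_norm_powr)
    also have "\<dots> = ennreal (\<Sum>i=1..3. C i) * ennpowr (bergman_norm p \<alpha> f) q"
      using C by (subst sum_ennreal[symmetric]) (auto simp: sum_distrib_right P_def less_imp_le)
    finally show "(\<Sum>i=1..3::nat. \<Sum>\<^sub>\<infinity>I\<in>\<D> i. ennpowr (emeasure (dA \<alpha>) (carleson_box I)) (q / p)
          * average \<alpha> (carleson_box I) (\<lambda>z. norm (f z) powr s1)
          * average \<alpha> (carleson_box I) (\<lambda>z. norm (f z) powr s2))
        \<le> ennreal (\<Sum>i=1..3. C i) * ennpowr (bergman_norm p \<alpha> f) q" .
  qed
qed

text \<open>The covering property is applied to the interval of radius \<open>Im z\<close> around \<open>Re z\<close>. Its length
  \<open>2 * Im z\<close> exceeds the height \<open>3 / 2 * Im z\<close> of the top of the disc, and the covering interval is at most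
  three times as long.\<close>

lemma covering_grid_box:
  assumes D: "covering_dyadic_grids \<D>" and z: "0 < Im z"
  obtains i J where "i \<in> {1..3}" "J \<in> \<D> i" "ball z (Im z / 2) \<subseteq> carleson_box J" "z \<in> carleson_box J"
    "ilength J \<le> 6 * Im z"
proof -
  define y where "y = Im z"
  define I where "I = {Re z - y..Re z + y}"
  have y: "0 < y"
    using z by (simp add: y_def)
  have I: "is_interval I" "bounded I" "ilength I = 2 * y"
    using y by (simp_all add: I_def ilength_def is_interval_cc)
  have "is_interval I \<and> bounded I \<and> ilength I > 0"
    using I y by simp
  then have "\<exists>i\<in>{1..3}. \<exists>J\<in>\<D> i. I \<subseteq> J \<and> ilength J \<le> 3 * ilength I"
    using D unfolding covering_dyadic_grids_def by blast
  then obtain i J where iJ: "i \<in> {1..3}" "J \<in> \<D> i" "I \<subseteq> J" "ilength J \<le> 3 * ilength I"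
    by blast
  then have "dyadic_grid (\<D> i)"
    using D unfolding covering_dyadic_grids_def by blast
  note J = dyadic_gridD(2,3)[OF this iJ(2)]
  have long: "2 * y \<le> ilength J"
    using ilength_mono[OF iJ(3) J(1) _ J(2)] I y by simp
  have ball: "ball z (y / 2) \<subseteq> carleson_box J"
  proof
    fix v assume v: "v \<in> ball z (y / 2)"
    \<comment> \<open>The disc lies over the middle half of \<open>I\<close> and below the height \<open>2 * y\<close>.\<close>
    have "\<bar>Re (z - v)\<bar> < y / 2"
      using v abs_Re_le_cmod[of "z - v"] by (simp add: dist_norm del: minus_complex.sel)
    then have "Re v \<in> I"
      unfolding I_def atLeastAtMost_iff minus_complex.sel using y by linarith
    then show "v \<in> carleson_box J"
      using ball_half_height_Im[of v z] v iJ(3) long y by (auto simp: carleson_box_iff y_def)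
  qed
  then show ?thesis
    using y iJ I by (intro that[of i J]) (auto simp: y_def)
qed

text \<open>Of the whole sum only the one term given by the box around the disc about \<open>z\<close> is kept. Splitting the
  exponent before applying the sub-mean value property yields the product of two means.\<close>

lemma norm_powr_le_grid_sum:
  assumes D: "covering_dyadic_grids \<D>" and \<alpha>: "-1 < \<alpha>" and s: "0 < s1" "0 < s2"
  shows "\<exists>C>0. \<forall>f. f holomorphic_on upper_half_plane \<longrightarrow> (\<forall>z\<in>upper_half_plane.
     ennreal (norm (f z) powr (s1 + s2))
       \<le> ennreal C * (\<Sum>i=1..3::nat. \<Sum>\<^sub>\<infinity>I\<in>\<D> i. indicator (carleson_box I) z
           * (average \<alpha> (carleson_box I) (\<lambda>z. norm (f z) powr s1)
              * average \<alpha> (carleson_box I) (\<lambda>z. norm (f z) powr s2))))"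
proof -
  define K where "K s = sub_mean_const \<alpha> s * box_const \<alpha> 0 * 6 powr (2 + \<alpha>)" for s
  have K: "0 < K s" for s
    using sub_mean_const_pos[OF \<alpha>] box_const_pos[of \<alpha> 0] \<alpha> by (simp add: K_def)
  show ?thesis
  proof (intro exI[of _ "K s1 * K s2"] conjI allI impI ballI)
    show "0 < K s1 * K s2"
      using K by simp
    fix f z assume f: "f holomorphic_on upper_half_plane" and "z \<in> upper_half_plane"
    then have z: "0 < Im z"
      by (simp add: upper_half_plane_def)
    define c where "c I = average \<alpha> (carleson_box I) (\<lambda>z. norm (f z) powr s1)
              * average \<alpha> (carleson_box I) (\<lambda>z. norm (f z) powr s2)" for I
    obtain i J where J: "i \<in> {1..3}" "J \<in> \<D> i" "ball z (Im z / 2) \<subseteq> carleson_box J"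
        "z \<in> carleson_box J" "ilength J \<le> 6 * Im z"
      using covering_grid_box[OF D z] by blast
    then have "dyadic_grid (\<D> i)"
      using D unfolding covering_dyadic_grids_def by blast
    note J' = dyadic_gridD(2,3)[OF this J(2)]
    have "ennreal (norm (f z) powr (s1 + s2)) = ennreal (norm (f z) powr s1) * ennreal (norm (f z) powr s2)"
      by (simp add: powr_add ennreal_mult)
    also have "\<dots> \<le> (ennreal (K s1) * average \<alpha> (carleson_box J) (\<lambda>z. norm (f z) powr s1))
        * (ennreal (K s2) * average \<alpha> (carleson_box J) (\<lambda>z. norm (f z) powr s2))"
      unfolding K_def using norm_powr_le_average[OF \<alpha> _ f z J' J(5,3)] s by (intro mult_mono) simp_all
    also have "\<dots> = ennreal (K s1 * K s2) * (indicator (carleson_box J) z * c J)"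
      using K J by (simp add: c_def ennreal_mult less_imp_le mult_ac)
    also have "indicator (carleson_box J) z * c J = (\<Sum>\<^sub>\<infinity>I\<in>{J}. indicator (carleson_box I) z * c I)"
      by (simp only: infsum_finite finite.intros sum.insert sum.empty empty_iff not_False_eq_True add_0_right)
    also have "\<dots> \<le> (\<Sum>\<^sub>\<infinity>I\<in>\<D> i. indicator (carleson_box I) z * c I)"
      using J by (intro infsum_mono_neutral nonneg_summable_on_complete) auto
    also have "\<dots> \<le> (\<Sum>i=1..3. \<Sum>\<^sub>\<infinity>I\<in>\<D> i. indicator (carleson_box I) z * c I)"
      using J(1) by (intro member_le_sum) auto
    finally show "ennreal (norm (f z) powr (s1 + s2))
       \<le> ennreal (K s1 * K s2) * (\<Sum>i=1..3::nat. \<Sum>\<^sub>\<infinity>I\<in>\<D> i. indicator (carleson_box I) z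
           * (average \<alpha> (carleson_box I) (\<lambda>z. norm (f z) powr s1)
              * average \<alpha> (carleson_box I) (\<lambda>z. norm (f z) powr s2)))"
      by (simp add: c_def mult_left_mono)
  qed
qed

text \<open>Substitute \<open>\<phi> z\<close> into the pointwise bound and integrate against \<open>norm u powr q\<close>: each indicator
  becomes the mass of a box, for which the Carleson condition gives the power \<open>q / p\<close> of the area.\<close>

lemma bounded_imp_grid_sum_bound:
  assumes D: "covering_dyadic_grids \<D>" and \<alpha>: "-1 < \<alpha>" and p: "0 < p"
    and s: "0 < s1" "0 < s2" "s1 + s2 = q"
    and u: "u holomorphic_on upper_half_plane"
    and \<phi>: "\<phi> holomorphic_on upper_half_plane" "\<phi> ` upper_half_plane \<subseteq> upper_half_plane"
    and bdd: "bergman_bounded \<alpha> p q (weighted_comp u \<phi>)"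
  shows "\<exists>C>0. \<forall>f\<in>bergman_space p \<alpha>.
      ennpowr (bergman_norm q \<alpha> (weighted_comp u \<phi> f)) q
        \<le> ennreal C * (\<Sum>i=1..3::nat. \<Sum>\<^sub>\<infinity>I\<in>\<D> i. ennpowr (emeasure (dA \<alpha>) (carleson_box I)) (q / p)
          * average \<alpha> (carleson_box I) (\<lambda>z. norm (f z) powr s1)
          * average \<alpha> (carleson_box I) (\<lambda>z. norm (f z) powr s2))"
proof -
  have q: "0 < q"
    using s by simp
  obtain C1 where C1: "0 < C1" and carleson: "\<And>I. is_interval I \<Longrightarrow> 0 < ilength I \<Longrightarrow>
      (\<integral>\<^sup>+z. ennreal (norm (u z) powr q) * indicator (carleson_box I) (\<phi> z) \<partial>dA \<alpha>)
        \<le> ennreal C1 * ennpowr (emeasure (dA \<alpha>) (carleson_box I)) (q / p)"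
    using bounded_imp_carleson_measure[OF \<alpha> p q u \<phi> bdd] by blast
  obtain C2 where C2: "0 < C2" and pointwise: "\<And>f z. f holomorphic_on upper_half_plane \<Longrightarrow>
     z \<in> upper_half_plane \<Longrightarrow> ennreal (norm (f z) powr (s1 + s2))
       \<le> ennreal C2 * (\<Sum>i=1..3::nat. \<Sum>\<^sub>\<infinity>I\<in>\<D> i. indicator (carleson_box I) z
           * (average \<alpha> (carleson_box I) (\<lambda>z. norm (f z) powr s1)
              * average \<alpha> (carleson_box I) (\<lambda>z. norm (f z) powr s2)))"
    using norm_powr_le_grid_sum[OF D \<alpha> s(1,2)] by blast
  show ?thesis
  proof (intro exI[of _ "C2 * C1"] conjI ballI)
    show "0 < C2 * C1"
      using C1 C2 by simp
    fix f assume "f \<in> bergman_space p \<alpha>"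
    then have f: "f holomorphic_on upper_half_plane"
      by (simp add: bergman_space_def)
    define c where "c I = average \<alpha> (carleson_box I) (\<lambda>z. norm (f z) powr s1)
              * average \<alpha> (carleson_box I) (\<lambda>z. norm (f z) powr s2)" for I
    define h where "h I z = ennreal (norm (u z) powr q) * indicator (carleson_box I) (\<phi> z)" for I z
    have grid: "dyadic_grid (\<D> i)" if "i \<in> {1..3}" for i
      using D that unfolding covering_dyadic_grids_def by blast
    have h_meas [measurable]: "h I \<in> borel_measurable (dA \<alpha>)" if "I \<in> \<D> i" "i \<in> {1..3}" for I i
    proof -
      have [measurable]: "(\<lambda>z. ennreal (norm (u z) powr q)) \<in> borel_measurable (dA \<alpha>)"
        "\<phi> \<in> borel_measurable (dA \<alpha>)"
        using continuous_on_measurable_dA[of u \<alpha>] continuous_on_measurable_dA[of \<phi> \<alpha>]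
          holomorphic_on_imp_continuous_on u \<phi>(1) by auto
      note [measurable] = carleson_box_borel[OF dyadic_gridD(2)[OF grid[OF that(2)] that(1)]]
      show ?thesis
        unfolding h_def by measurable
    qed
    have sum_meas: "(\<lambda>z. \<Sum>\<^sub>\<infinity>I\<in>\<D> i. c I * h I z) \<in> borel_measurable (dA \<alpha>)" if "i \<in> {1..3}" for i
      using h_meas[OF _ that]
      by (intro borel_measurable_infsum_ennreal countable_dyadic_grid[OF grid[OF that]]) simp
    have "ennpowr (bergman_norm q \<alpha> (weighted_comp u \<phi> f)) q
        = (\<integral>\<^sup>+z. ennreal (norm (u z * f (\<phi> z)) powr q) \<partial>dA \<alpha>)"
      using q by (simp add: bergman_norm_powr_same weighted_comp_def)
    also have "\<dots> \<le> (\<integral>\<^sup>+z. ennreal C2 * (\<Sum>i=1..3::nat. \<Sum>\<^sub>\<infinity>I\<in>\<D> i. c I * h I z) \<partial>dA \<alpha>)"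
    proof (rule nn_integral_mono)
      fix z assume "z \<in> space (dA \<alpha>)"
      then have "\<phi> z \<in> upper_half_plane"
        using \<phi>(2) by auto
      then have "ennreal (norm (u z) powr q) * ennreal (norm (f (\<phi> z)) powr q)
          \<le> ennreal (norm (u z) powr q) * (ennreal C2 * (\<Sum>i=1..3::nat. \<Sum>\<^sub>\<infinity>I\<in>\<D> i.
              indicator (carleson_box I) (\<phi> z) * c I))"
        using pointwise[OF f] unfolding c_def s(3) by (intro mult_left_mono) auto
      also have "\<dots> = ennreal C2 * (\<Sum>i=1..3::nat. \<Sum>\<^sub>\<infinity>I\<in>\<D> i.
          ennreal (norm (u z) powr q) * (indicator (carleson_box I) (\<phi> z) * c I))"
      proof -
        have "(\<Sum>i=1..3::nat. \<Sum>\<^sub>\<infinity>I\<in>\<D> i.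
            ennreal (norm (u z) powr q) * (indicator (carleson_box I) (\<phi> z) * c I))
          = ennreal (norm (u z) powr q) * (\<Sum>i=1..3::nat. \<Sum>\<^sub>\<infinity>I\<in>\<D> i.
            indicator (carleson_box I) (\<phi> z) * c I)"
          unfolding sum_distrib_left by (intro sum.cong refl infsum_ennreal_cmult) simp
        then show ?thesis
          by (simp only: mult.left_commute)
      qed
      finally show "ennreal (norm (u z * f (\<phi> z)) powr q)
          \<le> ennreal C2 * (\<Sum>i=1..3::nat. \<Sum>\<^sub>\<infinity>I\<in>\<D> i. c I * h I z)"
        by (simp add: norm_mult powr_mult ennreal_mult h_def mult_ac)
    qed
    also have "\<dots> = ennreal C2 * (\<Sum>i=1..3::nat. \<integral>\<^sup>+z. (\<Sum>\<^sub>\<infinity>I\<in>\<D> i. c I * h I z) \<partial>dA \<alpha>)"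
    proof -
      have "(\<integral>\<^sup>+z. ennreal C2 * (\<Sum>i=1..3::nat. \<Sum>\<^sub>\<infinity>I\<in>\<D> i. c I * h I z) \<partial>dA \<alpha>)
          = ennreal C2 * (\<integral>\<^sup>+z. (\<Sum>i=1..3::nat. \<Sum>\<^sub>\<infinity>I\<in>\<D> i. c I * h I z) \<partial>dA \<alpha>)"
        by (intro nn_integral_cmult borel_measurable_sum sum_meas)
      also have "(\<integral>\<^sup>+z. (\<Sum>i=1..3::nat. \<Sum>\<^sub>\<infinity>I\<in>\<D> i. c I * h I z) \<partial>dA \<alpha>)
          = (\<Sum>i=1..3::nat. \<integral>\<^sup>+z. (\<Sum>\<^sub>\<infinity>I\<in>\<D> i. c I * h I z) \<partial>dA \<alpha>)"
        by (intro nn_integral_sum sum_meas)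
      finally show ?thesis .
    qed
    also have "\<dots> = ennreal C2 * (\<Sum>i=1..3::nat. \<Sum>\<^sub>\<infinity>I\<in>\<D> i. c I * (\<integral>\<^sup>+z. h I z \<partial>dA \<alpha>))"
    proof (intro arg_cong2[where f = "(*)"] sum.cong refl)
      fix i :: nat assume i: "i \<in> {1..3}"
      have "(\<integral>\<^sup>+z. (\<Sum>\<^sub>\<infinity>I\<in>\<D> i. c I * h I z) \<partial>dA \<alpha>) = (\<Sum>\<^sub>\<infinity>I\<in>\<D> i. \<integral>\<^sup>+z. c I * h I z \<partial>dA \<alpha>)"
        using h_meas[OF _ i] by (intro nn_integral_infsum countable_dyadic_grid[OF grid[OF i]]) simp
      also have "\<dots> = (\<Sum>\<^sub>\<infinity>I\<in>\<D> i. c I * (\<integral>\<^sup>+z. h I z \<partial>dA \<alpha>))"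
        using h_meas[OF _ i] by (intro infsum_cong nn_integral_cmult)
      finally show "(\<integral>\<^sup>+z. (\<Sum>\<^sub>\<infinity>I\<in>\<D> i. c I * h I z) \<partial>dA \<alpha>) = (\<Sum>\<^sub>\<infinity>I\<in>\<D> i. c I * (\<integral>\<^sup>+z. h I z \<partial>dA \<alpha>))" .
    qed
    also have "\<dots> \<le> ennreal C2 * (\<Sum>i=1..3::nat. \<Sum>\<^sub>\<infinity>I\<in>\<D> i. ennreal C1 *
        (ennpowr (emeasure (dA \<alpha>) (carleson_box I)) (q / p) * c I))"
    proof (intro mult_left_mono sum_mono infsum_mono nonneg_summable_on_complete)
      fix i :: nat and I assume iI: "i \<in> {1..3}" "I \<in> \<D> i"
      have "c I * (\<integral>\<^sup>+z. h I z \<partial>dA \<alpha>)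
          \<le> c I * (ennreal C1 * ennpowr (emeasure (dA \<alpha>) (carleson_box I)) (q / p))"
        unfolding h_def using carleson dyadic_gridD[OF grid[OF iI(1)] iI(2)] by (intro mult_left_mono) auto
      then show "c I * (\<integral>\<^sup>+z. h I z \<partial>dA \<alpha>)
          \<le> ennreal C1 * (ennpowr (emeasure (dA \<alpha>) (carleson_box I)) (q / p) * c I)"
        by (simp only: mult_ac)
    qed simp_all
    also have "\<dots> = ennreal (C2 * C1) * (\<Sum>i=1..3::nat. \<Sum>\<^sub>\<infinity>I\<in>\<D> i.
        ennpowr (emeasure (dA \<alpha>) (carleson_box I)) (q / p) * c I)"
      using C1 C2 by (simp add: infsum_ennreal_cmult ennreal_mult less_imp_le mult.assoc flip: sum_distrib_left)
    finally show "ennpowr (bergman_norm q \<alpha> (weighted_comp u \<phi> f)) q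
        \<le> ennreal (C2 * C1) * (\<Sum>i=1..3::nat. \<Sum>\<^sub>\<infinity>I\<in>\<D> i. ennpowr (emeasure (dA \<alpha>) (carleson_box I)) (q / p)
          * average \<alpha> (carleson_box I) (\<lambda>z. norm (f z) powr s1)
          * average \<alpha> (carleson_box I) (\<lambda>z. norm (f z) powr s2))"
      by (simp add: c_def mult.assoc)
  qed
qed

lemma Z_setD:
  assumes "N \<in> Z_set p q"
  shows "0 < real N" "real N < p" "0 < q - real N" "q - real N < p"
  using assms by (auto simp: Z_set_def)

lemma finite_Z_set: "finite (Z_set p q)"
proof (rule finite_subset)
  show "Z_set p q \<subseteq> {..nat \<lceil>p\<rceil>}"
    by (auto simp: Z_set_def) linarith
qed simp

lemma norm_power_eq_powr:
  "N \<in> Z_set p q \<Longrightarrow> norm w ^ N = norm w powr real N"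
  by (simp add: Z_set_def powr_realpow')

theorem theorem4p5:
  fixes p q \<alpha> :: real
    and u \<phi> :: "complex \<Rightarrow> complex"
    and \<D> :: "nat \<Rightarrow> real set set"
  assumes "2 * p > q" and "q > p" and "p \<ge> 1" and "\<alpha> > -1"
    and "u holomorphic_on upper_half_plane"
    and "\<phi> holomorphic_on upper_half_plane"
    and "\<phi> ` upper_half_plane \<subseteq> upper_half_plane"
    and "covering_dyadic_grids \<D>"
    and "Z_set p q \<noteq> {}"
  shows "bergman_bounded \<alpha> p q (weighted_comp u \<phi>) \<longleftrightarrow>
    (\<exists>C::real. C > 0 \<and>
      (\<forall>f\<in>bergman_space p \<alpha>.
         ennpowr (bergman_norm q \<alpha> (weighted_comp u \<phi> f)) q
         \<le> ennreal C *
            (INF N\<in>Z_set p q.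
               \<Sum>i=1..3. \<Sum>\<^sub>\<infinity>I\<in>\<D> i.
                 ennpowr (emeasure (dA \<alpha>) (carleson_box I)) (q / p)
                 * average \<alpha> (carleson_box I) (\<lambda>z. norm (f z) ^ N)
                 * average \<alpha> (carleson_box I) (\<lambda>z. norm (f z) powr (q - real N)))))"
    (is "?bounded \<longleftrightarrow> (\<exists>C::real. C > 0 \<and> (\<forall>f\<in>bergman_space p \<alpha>. ?lhs f \<le> ennreal C * (INF N\<in>?Z. ?S f N)))")
proof
  have S_eq: "?S f N = (\<Sum>i=1..3. \<Sum>\<^sub>\<infinity>I\<in>\<D> i.
                 ennpowr (emeasure (dA \<alpha>) (carleson_box I)) (q / p)
                 * average \<alpha> (carleson_box I) (\<lambda>z. norm (f z) powr real N)
                 * average \<alpha> (carleson_box I) (\<lambda>z. norm (f z) powr (q - real N)))"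
    if "N \<in> ?Z" for f :: "complex \<Rightarrow> complex" and N
    using that by (simp add: norm_power_eq_powr[OF that])
  {
    assume bdd: ?bounded
    have "\<exists>C>0. \<forall>f\<in>bergman_space p \<alpha>. ?lhs f \<le> ennreal C * ?S f N" if N: "N \<in> ?Z" for N
      unfolding S_eq[OF N]
      by (rule bounded_imp_grid_sum_bound) (use assms Z_setD[OF N] bdd in auto)
    then have "\<forall>N\<in>?Z. \<exists>C. 0 < C \<and> (\<forall>f\<in>bergman_space p \<alpha>. ?lhs f \<le> ennreal C * ?S f N)"
      by blast
    from bchoice[OF this] obtain C where C: "\<And>N. N \<in> ?Z \<Longrightarrow> 0 < C N"
      "\<And>N f. N \<in> ?Z \<Longrightarrow> f \<in> bergman_space p \<alpha> \<Longrightarrow> ?lhs f \<le> ennreal (C N) * ?S f N"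
      by blast
    show "\<exists>C::real. C > 0 \<and> (\<forall>f\<in>bergman_space p \<alpha>. ?lhs f \<le> ennreal C * (INF N\<in>?Z. ?S f N))"
    proof (intro exI[of _ "\<Sum>N\<in>?Z. C N"] conjI ballI)
      show "0 < (\<Sum>N\<in>?Z. C N)"
        using C(1) finite_Z_set assms by (intro sum_pos) auto
      fix f assume f: "f \<in> bergman_space p \<alpha>"
      \<comment> \<open>Finitely many \<open>N\<close> compete, so the infimum is attained and one constant serves them all.\<close>
      have "(INF N\<in>?Z. ?S f N) \<in> ?S f ` ?Z"
        using finite_Z_set assms by (simp add: cInf_eq_Min)
      then obtain M where M: "M \<in> ?Z" "(INF N\<in>?Z. ?S f N) = ?S f M"
        by blast
      have "C M \<le> (\<Sum>N\<in>?Z. C N)"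
        using C(1) M finite_Z_set by (intro member_le_sum) (auto intro: less_imp_le)
      then have "ennreal (C M) * ?S f M \<le> ennreal (\<Sum>N\<in>?Z. C N) * ?S f M"
        by (intro mult_right_mono ennreal_leI) simp_all
      then show "?lhs f \<le> ennreal (\<Sum>N\<in>?Z. C N) * (INF N\<in>?Z. ?S f N)"
        unfolding M(2) using C(2)[OF M(1) f] by (rule order_trans[rotated])
    qed
  next
    assume "\<exists>C::real. C > 0 \<and> (\<forall>f\<in>bergman_space p \<alpha>. ?lhs f \<le> ennreal C * (INF N\<in>?Z. ?S f N))"
    then obtain C where C: "0 < C"
      "\<And>f. f \<in> bergman_space p \<alpha> \<Longrightarrow> ?lhs f \<le> ennreal C * (INF N\<in>?Z. ?S f N)"
      by blast
    obtain N where N: "N \<in> ?Z"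
      using assms by blast
    have grids: "\<And>i. i \<in> {1..3} \<Longrightarrow> dyadic_grid (\<D> i)"
      using assms(8) unfolding covering_dyadic_grids_def by blast
    have "\<exists>K>0. \<forall>f\<in>bergman_space p \<alpha>. ?S f N \<le> ennreal K * ennpowr (bergman_norm p \<alpha> f) q"
      unfolding S_eq[OF N]
      by (rule dyadic_sums_bounded) (use assms Z_setD[OF N] grids in auto)
    then obtain K where K: "0 < K"
      "\<And>f. f \<in> bergman_space p \<alpha> \<Longrightarrow> ?S f N \<le> ennreal K * ennpowr (bergman_norm p \<alpha> f) q"
      by blast
    show ?bounded
      unfolding bergman_bounded_def
    proof (intro exI[of _ "(C * K) powr (1 / q)"] ballI)
      fix f assume f: "f \<in> bergman_space p \<alpha>"
      have q: "0 < q"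
        using assms by simp
      have "?lhs f \<le> ennreal C * (INF N\<in>?Z. ?S f N)"
        by (rule C(2)[OF f])
      also have "\<dots> \<le> ennreal C * ?S f N"
        by (intro mult_left_mono INF_lower N) simp
      also have "\<dots> \<le> ennreal C * (ennreal K * ennpowr (bergman_norm p \<alpha> f) q)"
        by (intro mult_left_mono K(2)[OF f]) simp
      also have "\<dots> = ennreal (C * K) * ennpowr (bergman_norm p \<alpha> f) q"
        using C(1) K(1) by (simp add: ennreal_mult mult.assoc)
      finally have "ennpowr (?lhs f) (1 / q) \<le> ennpowr (ennreal (C * K) * ennpowr (bergman_norm p \<alpha> f) q) (1 / q)"
        using q by (intro ennpowr_mono) simp_all
      also have "\<dots> = ennreal ((C * K) powr (1 / q)) * bergman_norm p \<alpha> f"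
        using q C(1) K(1) by (simp add: ennpowr_cmult ennpowr_ennpowr ennpowr_one)
      finally show "bergman_norm q \<alpha> (weighted_comp u \<phi> f) \<le> ennreal ((C * K) powr (1 / q)) * bergman_norm p \<alpha> f"
        using q by (simp add: ennpowr_ennpowr ennpowr_one)
    qed
  }
qed

end
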